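(* Let $\theta$ be a $d$-dimensional, nontrivial, primitive, bijective rectangular substitution over a finite alphabet $\mathcal{A}$ such that the shift action on the associated minimal substitutive subshift $\mathsf{X}_\theta^\circ$ is faithful. Then $$\psi[\mathrm{Sym}(\mathsf{X}_\theta^\circ,\mathbb{Z}^d)]\le Q_d<\mathrm{GL}_d(\mathbb{Z}),$$ where $Q_d$ is the group of signed permutation matrices. Hence, the extended symmetry group $\mathrm{Sym}(\mathsf{X}_\theta^\circ,\mathbb{Z}^d)$ is virtually $\mathbb{Z}^d$, i.e. has a finite-index subgroup isomorphic to $\mathbb{Z}^d$.
   Context: For a finite set $\mathcal{A}$ (alphabet), $\mathcal{A}^{\mathbb{Z}^d}$ carries the product topology of the discrete topology, and the shift action is $(\sigma_{\vec{g}}(x))_{\vec{h}}=x_{\vec{h}-\vec{g}}$. The shift action on a subshift $X$ (closed shift-invariant subset) is faithful if $\sigma_{\vec{k}}|_X=\mathrm{id}$ only for $\vec{k}=\vec{0}$. An extended symmetry of $X$ is a bijective continuous map $f:X\to X$ for which there is $A\in\mathrm{GL}_d(\mathbb{Z})$ with $f\circ\sigma_{\vec{p}}=\sigma_{A\vec{p}}\circ f$ for all $\vec{p}\in\mathbb{Z}^d$; the extended symmetries form a group $\mathrm{Sym}(X,\mathbb{Z}^d)$ under composition. When the shift action on $X$ is faithful, $A$ is determined by $f$, and $\psi:\mathrm{Sym}(X,\mathbb{Z}^d)\to\mathrm{GL}_d(\mathbb{Z})$, $\psi(f)=A$, is a group morphism. $Q_d<\mathrm{GL}_d(\mathbb{Z})$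 is the (standard copy of the) hyperoctahedral group: all matrices $[\pm\vec{e}_{\pi(1)}\mid\cdots\mid\pm\vec{e}_{\pi(d)}]$ with $\pi$ a permutation of $\{1,\dots,d\}$ and arbitrary signs. A rectangular substitution is a map $\theta:\mathcal{A}\to\mathcal{A}^S$ with $S=\prod_{i=1}^d\{0,\dots,s_i-1\}$; "nontrivial" means $s_i>1$ for all $i$. Products of vectors are componentwise. The iterates $\theta^n(a)$, $a\in\mathcal{A}$, are the patterns with support $\prod_i\{0,\dots,s_i^n-1\}$ given by $\theta^1=\theta$ and $\theta^{n+1}(a)_{\vec{m}\cdot\vec{s}+\vec{k}}=\theta(\theta^n(a)_{\vec{m}})_{\vec{k}}$ for $\vec{k}\in S$. $\theta$ is primitive if for some $n$, for every $a\in\mathcal{A}$, $\theta^n(a)$ contains every symbol of $\mathcal{A}$. $\theta$ is bijective if for each $\vec{k}\in S$ the map $a\mapsto\theta(a)_{\vec{k}}$ is a bijection of $\mathcal{A}$. The minimal substitutive subshift $\mathsf{X}_\theta^\circ$ is the set of $x\in\mathcal{A}^{\mathbb{Z}^d}$ such that for every finite $U\subset\mathbb{Z}^d$ the pattern $x|_U$ occurs, up to translation, as a subpattern of $\theta^k(a)$ for some $k\in\mathbb{N}$, $a\in\mathcal{A}$. *)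

theory Defs
  imports "HOL-Analysis.Analysis" "HOL-Algebra.Bij" "HOL-Algebra.Coset"
begin

text \<open>
  The dimension is the cardinality of the index type \<open>'d\<close> and the alphabet is the finite type
  \<open>'a\<close>, so a configuration is a function \<open>int ^ 'd \<Rightarrow> 'a\<close>.
\<close>

definition full_shift_topology :: "(int ^ 'd \<Rightarrow> 'a) topology" where
  "full_shift_topology = product_topology (\<lambda>_. discrete_topology UNIV) UNIV"

definition shift :: "int ^ 'd \<Rightarrow> (int ^ 'd \<Rightarrow> 'a) \<Rightarrow> (int ^ 'd \<Rightarrow> 'a)" where
  "shift g x = (\<lambda>h. x (h - g))"

definition faithful_shift :: "(int ^ 'd \<Rightarrow> 'a) set \<Rightarrow> bool" where
  "faithful_shift X \<longleftrightarrow> (\<forall>k. (\<forall>x\<in>X. shift k x = x) \<longrightarrow> k = 0)"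

definition intertwines ::
    "(int ^ 'd \<Rightarrow> 'a) set \<Rightarrow> ((int ^ 'd \<Rightarrow> 'a) \<Rightarrow> (int ^ 'd \<Rightarrow> 'a)) \<Rightarrow> int ^ 'd ^ 'd \<Rightarrow> bool" where
  "intertwines X f A \<longleftrightarrow> (\<forall>p. \<forall>x\<in>X. f (shift p x) = shift (A *v p) (f x))"

text \<open>
  Self-maps of \<open>X\<close> are represented by the elements of \<^term>\<open>extensional X\<close> (via \<^const>\<open>Bij\<close>), so that
  two extended symmetries are equal as soon as they agree on \<open>X\<close>.
  For an integer matrix, \<^const>\<open>invertible\<close> means having an inverse with integer entries.
\<close>

definition ext_symmetries ::
    "(int ^ 'd \<Rightarrow> 'a) set \<Rightarrow> ((int ^ 'd \<Rightarrow> 'a) \<Rightarrow> (int ^ 'd \<Rightarrow> 'a)) set" where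
  "ext_symmetries X =
     {f \<in> Bij X.
        continuous_map (subtopology full_shift_topology X) (subtopology full_shift_topology X) f \<and>
        (\<exists>A. invertible A \<and> intertwines X f A)}"

definition Sym_group ::
    "(int ^ 'd \<Rightarrow> 'a) set \<Rightarrow> ((int ^ 'd \<Rightarrow> 'a) \<Rightarrow> (int ^ 'd \<Rightarrow> 'a)) monoid" where
  "Sym_group X = (BijGroup X)\<lparr>carrier := ext_symmetries X\<rparr>"

definition psi ::
    "(int ^ 'd \<Rightarrow> 'a) set \<Rightarrow> ((int ^ 'd \<Rightarrow> 'a) \<Rightarrow> (int ^ 'd \<Rightarrow> 'a)) \<Rightarrow> int ^ 'd ^ 'd" where
  "psi X f = (THE A. invertible A \<and> intertwines X f A)"

lemma intertwines_unique:
  fixes X :: "(int ^ 'd \<Rightarrow> 'a) set"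
  assumes faithful: "faithful_shift X" and bij: "f \<in> Bij X"
    and A: "intertwines X f A" and B: "intertwines X f B"
  shows "A = B"
proof -
  have "A *v p = B *v p" for p
  proof -
    have "shift (A *v p - B *v p) y = y" if "y \<in> X" for y
    proof -
      obtain x where x: "x \<in> X" "y = f x"
        using bij \<open>y \<in> X\<close> by (force simp: Bij_def bij_betw_def)
      then have "shift (A *v p) y = shift (B *v p) y"
        using A B unfolding intertwines_def by metis
      then have "y (h - A *v p) = y (h - B *v p)" for h
        unfolding shift_def by (rule fun_cong)
      from this[of "h + B *v p" for h] have "y (h + B *v p - A *v p) = y h" for h
        by simp
      moreover have "h - (A *v p - B *v p) = h + B *v p - A *v p" for h
        by simp
      ultimately show ?thesis
        by (simp only: shift_def)
    qed
    then show ?thesis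
      using faithful[unfolded faithful_shift_def, rule_format, of "A *v p - B *v p"] by simp
  qed
  then show ?thesis
    using matrix_eq[of A B] by blast
qed

lemma psi_eq:
  assumes "faithful_shift X" "f \<in> Bij X" "invertible A" "intertwines X f A"
  shows "psi X f = A"
  unfolding psi_def using assms by (intro the_equality conjI) (auto dest: intertwines_unique)

definition GL_int :: "(int ^ 'd ^ 'd) monoid" where
  "GL_int = \<lparr>carrier = {A. invertible A}, mult = (**), one = mat 1\<rparr>"

definition hyperoctahedral :: "(int ^ 'd ^ 'd) set" where
  "hyperoctahedral =
     {A. \<exists>\<pi>. \<pi> permutes UNIV \<and> (\<forall>j. column j A \<in> {axis (\<pi> j) 1, - axis (\<pi> j) 1})}"

definition int_lattice :: "(int ^ 'd) monoid" where
  "int_lattice = \<lparr>carrier = UNIV, mult = (+), one = 0\<rparr>"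

definition virtually :: "('g, 'x) monoid_scheme \<Rightarrow> ('h, 'y) monoid_scheme \<Rightarrow> bool" where
  "virtually G K \<longleftrightarrow>
     group G \<and> (\<exists>H. subgroup H G \<and> finite (rcosets\<^bsub>G\<^esub> H) \<and> G\<lparr>carrier := H\<rparr> \<cong> K)"

text \<open>
  A rectangular substitution is given by its side lengths \<open>s\<close> and a map
  \<open>\<theta> :: 'a \<Rightarrow> int ^ 'd \<Rightarrow> 'a\<close>. Only the values of \<open>\<theta> a\<close> on \<open>box_support s\<close> matter; all
  notions below ignore the values of \<open>\<theta> a\<close> elsewhere. Likewise, \<open>subst_iter s \<theta> n a\<close> is only
  meaningful on \<open>box_support (side_power s n)\<close>.
\<close>

definition box_support :: "int ^ 'd \<Rightarrow> (int ^ 'd) set" where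
  "box_support s = {k. \<forall>i. 0 \<le> k $ i \<and> k $ i < s $ i}"

definition side_power :: "int ^ 'd \<Rightarrow> nat \<Rightarrow> int ^ 'd" where
  "side_power s n = (\<chi> i. (s $ i) ^ n)"

primrec subst_iter :: "int ^ 'd \<Rightarrow> ('a \<Rightarrow> int ^ 'd \<Rightarrow> 'a) \<Rightarrow> nat \<Rightarrow> 'a \<Rightarrow> int ^ 'd \<Rightarrow> 'a" where
  "subst_iter s \<theta> 0 a = (\<lambda>_. a)"
| "subst_iter s \<theta> (Suc n) a =
     (\<lambda>m. \<theta> (subst_iter s \<theta> n a (\<chi> i. m $ i div s $ i)) (\<chi> i. m $ i mod s $ i))"

lemma subst_iter_1:
  assumes "k \<in> box_support s"
  shows "subst_iter s \<theta> 1 a k = \<theta> a k"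
  using assms by (simp add: box_support_def vec_eq_iff)

lemma subst_iter_step:
  assumes "k \<in> box_support s"
  shows "subst_iter s \<theta> (Suc n) a (m * s + k) = \<theta> (subst_iter s \<theta> n a m) k"
proof -
  have "(m * s + k) $ i div s $ i = m $ i" "(m * s + k) $ i mod s $ i = k $ i" for i
  proof -
    have "0 \<le> k $ i" "k $ i < s $ i"
      using assms by (auto simp: box_support_def)
    then show "(m * s + k) $ i div s $ i = m $ i" "(m * s + k) $ i mod s $ i = k $ i"
      by simp_all
  qed
  then show ?thesis
    by simp
qed

definition nontrivial_subst :: "int ^ 'd \<Rightarrow> bool" where
  "nontrivial_subst s \<longleftrightarrow> (\<forall>i. s $ i > 1)"

definition primitive_subst :: "int ^ 'd \<Rightarrow> ('a \<Rightarrow> int ^ 'd \<Rightarrow> 'a) \<Rightarrow> bool" where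
  "primitive_subst s \<theta> \<longleftrightarrow>
     (\<exists>n\<ge>1. \<forall>a b. \<exists>m\<in>box_support (side_power s n). subst_iter s \<theta> n a m = b)"

definition bijective_subst :: "int ^ 'd \<Rightarrow> ('a \<Rightarrow> int ^ 'd \<Rightarrow> 'a) \<Rightarrow> bool" where
  "bijective_subst s \<theta> \<longleftrightarrow> (\<forall>k\<in>box_support s. bij (\<lambda>a. \<theta> a k))"

definition minimal_subshift ::
    "int ^ 'd \<Rightarrow> ('a \<Rightarrow> int ^ 'd \<Rightarrow> 'a) \<Rightarrow> (int ^ 'd \<Rightarrow> 'a) set" where
  "minimal_subshift s \<theta> =
     {x. \<forall>U. finite U \<longrightarrow>
        (\<exists>k\<ge>1. \<exists>a v. \<forall>u\<in>U. u + v \<in> box_support (side_power s k) \<and>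
                           subst_iter s \<theta> k a (u + v) = x u)}"

end

theory Submission
  imports Defs
begin

text \<open>
  An \<^emph>\<open>address\<close> of level \<open>n\<close> of a point \<open>x\<close> is an offset for which \<open>x\<close> is a concatenation of blocks
  \<open>\<theta>\<^sup>n(a)\<close>. By repetitivity and a counting argument, two points of the subshift that agree on
  arbitrarily large cubes have the same addresses, so by bijectivity the set where they differ is a union
  of blocks of every level; unique desubstitution is not required. Faithfulness yields, for every
  direction \<open>i\<close>, two points that differ exactly on the half space \<open>m\<^sub>i \<ge> 0\<close>. An extended symmetry
  with matrix \<open>A\<close> sends this pair to two points that differ, up to a bounded distance, exactly on the
  image of the half space under \<open>A\<close>. Unless its bounding hyperplane is parallel to a coordinate
  hyperplane, it cuts deeply into some large block, which is impossible. Hence the rows of the inverse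
  of \<open>A\<close>, and by symmetry those of \<open>A\<close>, have one nonzero entry each.

  For the index of the shifts it suffices to consider symmetries \<open>h\<close> commuting with the shift. For large
  \<open>n\<close>, on points of the form \<open>\<theta>\<^sup>n(x)\<close> such an \<open>h\<close> is a letter map \<open>\<tau>\<close> applied to \<open>x\<close> followed by \<open>\<theta>\<^sup>n\<close> and a
  shift, so up to shifts there are no more such \<open>h\<close> than maps \<open>\<tau>\<close>.
\<close>

section \<open>Local rules\<close>

lemma openin_cylinder:
  fixes x :: "'i \<Rightarrow> 'b"
  assumes "finite F"
  shows "openin (product_topology (\<lambda>_. discrete_topology UNIV) UNIV) {y. \<forall>m\<in>F. y m = x m}"
proof -
  have "{y. \<forall>m\<in>F. y m = x m} = (\<Pi>\<^sub>E m\<in>UNIV. if m \<in> F then {x m} else UNIV)"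
    by (auto simp: PiE_iff split: if_splits)
  moreover have "finite {m. (if m \<in> F then {x m} else UNIV) \<noteq> (UNIV :: 'b set)}"
    using assms by (rule rev_finite_subset) auto
  ultimately show ?thesis
    by (simp add: openin_PiE_gen)
qed

text \<open>By Tychonoff the product is compact, so the nested closures of the tails of
  \<open>z\<close> have a common point. The index type may be uncountable, hence agreement on finite
  sets instead of a convergent subsequence.\<close>

lemma cluster_point:
  fixes z :: "nat \<Rightarrow> 'i \<Rightarrow> 'b::finite"
  shows "\<exists>x. \<forall>F N. finite F \<longrightarrow> (\<exists>n\<ge>N. \<forall>m\<in>F. z n m = x m)"
proof -
  define P :: "('i \<Rightarrow> 'b) topology" where "P = product_topology (\<lambda>_. discrete_topology UNIV) UNIV"
  have "compact_space P"
    by (simp add: P_def compact_space_product_topology compact_space_discrete_topology)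
  moreover have "Abstract_Topology.closure_of P (z ` {N..}) \<noteq> {}" for N
    by (auto simp: closure_of_eq_empty_gen P_def disjnt_def)
  moreover have "decseq (\<lambda>N. Abstract_Topology.closure_of P (z ` {N..}))"
    by (auto simp: decseq_def intro!: closure_of_mono)
  ultimately have "(\<Inter>N. Abstract_Topology.closure_of P (z ` {N..})) \<noteq> {}"
    by (intro compact_space_imp_nest[of P]) auto
  then obtain x where x: "\<And>N. x \<in> Abstract_Topology.closure_of P (z ` {N..})"
    by auto
  have "\<exists>n\<ge>N. \<forall>m\<in>F. z n m = x m" if "finite F" for F N
  proof -
    have "openin P {y. \<forall>m\<in>F. y m = x m}"
      unfolding P_def by (rule openin_cylinder[OF that])
    then have "\<exists>y. y \<in> z ` {N..} \<and> y \<in> {y. \<forall>m\<in>F. y m = x m}"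
      using x[of N, unfolded in_closure_of, THEN conjunct2, rule_format, of "{y. \<forall>m\<in>F. y m = x m}"]
      by blast
    then show ?thesis
      by auto
  qed
  then show ?thesis
    by blast
qed

lemma cylinder_subset_openin:
  fixes x :: "'i \<Rightarrow> 'b"
  assumes "openin (product_topology (\<lambda>_. discrete_topology UNIV) UNIV) S" "x \<in> S"
  obtains F where "finite F" "{y. \<forall>m\<in>F. y m = x m} \<subseteq> S"
proof -
  obtain U where U: "finite {i. U i \<noteq> UNIV}" "x \<in> PiE UNIV U" "PiE UNIV U \<subseteq> S"
    using assms by (auto simp: openin_product_topology_alt)
  have "{y. \<forall>m\<in>{i. U i \<noteq> UNIV}. y m = x m} \<subseteq> PiE UNIV U"
  proof
    fix y assume y: "y \<in> {y. \<forall>m\<in>{i. U i \<noteq> UNIV}. y m = x m}"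
    have "y i \<in> U i" for i
      using y U(2) by (cases "U i = UNIV") (auto simp: PiE_iff)
    then show "y \<in> PiE UNIV U"
      by (simp add: PiE_iff)
  qed
  then have "{y. \<forall>m\<in>{i. U i \<noteq> UNIV}. y m = x m} \<subseteq> S"
    using U(3) by (rule order_trans)
  then show thesis
    by (rule that[OF U(1)])
qed

text \<open>Letters are discrete, so each coordinate of the image is locally constant. The window
  \<open>F\<close> may depend on \<open>x\<close>; uniform windows come from compactness in
  \<open>local_rule\<close>.\<close>

lemma continuous_map_full_shift_iff:
  fixes X :: "(int ^ 'd \<Rightarrow> 'a) set"
  shows "continuous_map (subtopology full_shift_topology X) (subtopology full_shift_topology X) f \<longleftrightarrow>
    f \<in> X \<rightarrow> X \<and>
    (\<forall>x\<in>X. \<forall>m. \<exists>F. finite F \<and> (\<forall>y\<in>X. (\<forall>k\<in>F. y k = x k) \<longrightarrow> f y m = f x m))"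
    (is "?L \<longleftrightarrow> ?R")
proof
  have top: "topspace (full_shift_topology :: (int ^ 'd \<Rightarrow> 'a) topology) = UNIV"
    by (simp add: full_shift_topology_def)
  assume L: ?L
  then have "f \<in> X \<rightarrow> X"
    by (auto simp: continuous_map_def top)
  moreover have "\<exists>F. finite F \<and> (\<forall>y\<in>X. (\<forall>k\<in>F. y k = x k) \<longrightarrow> f y m = f x m)"
    if x: "x \<in> X" for x m
  proof -
    have "openin full_shift_topology {y. \<forall>k\<in>{m}. y k = f x k}"
      unfolding full_shift_topology_def by (rule openin_cylinder) simp
    then have "openin (subtopology full_shift_topology X) {z \<in> X. f z \<in> {y. \<forall>k\<in>{m}. y k = f x k}}"
      using L openin_continuous_map_preimage
      by (fastforce simp: continuous_map_in_subtopology top)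
    then obtain T where T: "openin full_shift_topology T" "{z \<in> X. f z m = f x m} = T \<inter> X"
      by (auto simp: openin_subtopology)
    have "x \<in> T"
      using T x by auto
    then obtain F where "finite F" "{y. \<forall>k\<in>F. y k = x k} \<subseteq> T"
      by (rule cylinder_subset_openin[OF T(1)[unfolded full_shift_topology_def]]) blast
    then show ?thesis
      using T by blast
  qed
  ultimately show ?R
    by blast
next
  have top: "topspace (full_shift_topology :: (int ^ 'd \<Rightarrow> 'a) topology) = UNIV"
    by (simp add: full_shift_topology_def)
  assume R: ?R
  then have R': "\<exists>F. finite F \<and> (\<forall>y\<in>X. (\<forall>k\<in>F. y k = x k) \<longrightarrow> f y m = f x m)" if "x \<in> X" for x m
    using that by (elim conjE) (drule (1) bspec, erule spec)
  have "continuous_map (subtopology full_shift_topology X) (discrete_topology UNIV) (\<lambda>x. f x m)" for m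
  proof -
    have "openin (subtopology full_shift_topology X) {x \<in> X. f x m \<in> U}" for U
    proof (subst openin_subopen, safe)
      fix x assume x: "x \<in> X" "f x m \<in> U"
      then obtain F where F: "finite F" "\<forall>y\<in>X. (\<forall>k\<in>F. y k = x k) \<longrightarrow> f y m = f x m"
        using R'[OF x(1), of m] by blast
      have "openin (subtopology full_shift_topology X) ({y. \<forall>k\<in>F. y k = x k} \<inter> X)" (is "openin _ ?T")
        unfolding full_shift_topology_def by (intro openin_subtopology_Int openin_cylinder F)
      moreover have "x \<in> ?T"
        using x by simp
      moreover have "?T \<subseteq> {x \<in> X. f x m \<in> U}"
      proof
        fix y assume "y \<in> ?T"
        then have "y \<in> X" "f y m = f x m"
          using F(2) by simp_all
        then show "y \<in> {x \<in> X. f x m \<in> U}"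
          using x(2) by simp
      qed
      ultimately show "\<exists>T. openin (subtopology full_shift_topology X) T \<and> x \<in> T \<and> T \<subseteq> {x \<in> X. f x m \<in> U}"
        by blast
    qed
    then show ?thesis
      by (auto simp: continuous_map_def top)
  qed
  then have "continuous_map (subtopology full_shift_topology X) full_shift_topology f"
    by (subst (2) full_shift_topology_def) (simp add: continuous_map_componentwise_UNIV)
  with R show ?L
    by (auto simp: continuous_map_in_subtopology top)
qed

lemma continuous_map_full_shift_local:
  assumes "continuous_map (subtopology full_shift_topology X) (subtopology full_shift_topology X) f"
    and "x \<in> X"
  shows "\<exists>F. finite F \<and> (\<forall>y\<in>X. (\<forall>k\<in>F. y k = x k) \<longrightarrow> f y m = f x m)"
  using assms(1)[unfolded continuous_map_full_shift_iff, THEN conjunct2, rule_format, OF assms(2)] .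

section \<open>Cubes as windows\<close>

definition cube :: "int \<Rightarrow> (int ^ 'd) set" where
  "cube r = {m. \<forall>i. \<bar>m $ i\<bar> \<le> r}"

lemma finite_vec_box:
  assumes "\<And>i. finite (S i)"
  shows "finite {m :: 'b ^ 'd. \<forall>i. m $ i \<in> S i}"
proof (rule finite_imageD)
  show "finite (vec_nth ` {m :: 'b ^ 'd. \<forall>i. m $ i \<in> S i})"
    by (rule finite_subset[OF _ finite_PiE[of UNIV S]]) (auto simp: PiE_iff assms)
  show "inj_on vec_nth {m :: 'b ^ 'd. \<forall>i. m $ i \<in> S i}"
    by (auto intro: inj_onI simp: vec_nth_inject)
qed

lemma finite_cube: "finite (cube r)"
  using finite_vec_box[of "\<lambda>_. {-r..r}"] by (simp add: cube_def abs_le_iff minus_le_iff conj_commute)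

lemma cube_mono: "r \<le> r' \<Longrightarrow> cube r \<subseteq> cube r'"
  by (auto simp: cube_def intro: order_trans)

lemma finite_subset_cube:
  fixes F :: "(int ^ 'd) set"
  assumes "finite F"
  obtains r where "r \<ge> 0" "F \<subseteq> cube r"
proof
  \<comment> \<open>A sum bounds every coordinate and, unlike a maximum, also covers the empty
    set.\<close>
  define r where "r = (\<Sum>m\<in>F. \<Sum>i\<in>UNIV. \<bar>m $ i\<bar>)"
  show "r \<ge> 0"
    by (auto simp: r_def intro!: sum_nonneg)
  have "\<bar>m $ i\<bar> \<le> r" if "m \<in> F" for m i
  proof -
    have "\<bar>m $ i\<bar> \<le> (\<Sum>i\<in>UNIV. \<bar>m $ i\<bar>)"
      by (rule member_le_sum) auto
    also have "\<dots> \<le> r"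
      unfolding r_def using assms that by (intro member_le_sum) (auto intro!: sum_nonneg)
    finally show ?thesis .
  qed
  then show "F \<subseteq> cube r"
    by (auto simp: cube_def)
qed

section \<open>Closed shift-invariant sets and uniform windows\<close>

lemma shift_apply [simp]: "shift g x h = x (h - g)"
  by (simp add: shift_def)

lemma shift_shift: "shift p (shift q x) = shift (p + q) x"
  by (simp add: shift_def fun_eq_iff algebra_simps)

lemma shift_zero [simp]: "shift 0 x = x"
  by (simp add: shift_def)

text \<open>\<open>closed\<close> is topological closedness written through cylinders: a point all
  of whose finite patterns are matched by points of \<open>X\<close> lies in
  \<open>X\<close>.\<close>

locale closed_subshift =
  fixes X :: "(int ^ 'd \<Rightarrow> 'a::finite) set"
  assumes shift_in: "x \<in> X \<Longrightarrow> shift p x \<in> X"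
    and closed: "(\<And>F. finite F \<Longrightarrow> \<exists>y\<in>X. \<forall>m\<in>F. y m = x m) \<Longrightarrow> x \<in> X"
begin

lemma cluster_pair:
  fixes x y :: "nat \<Rightarrow> int ^ 'd \<Rightarrow> 'a"
  assumes "\<And>n. x n \<in> X" "\<And>n. y n \<in> X"
  shows "\<exists>x'\<in>X. \<exists>y'\<in>X. \<forall>F N. finite F \<longrightarrow> (\<exists>n\<ge>N. \<forall>m\<in>F. x n m = x' m \<and> y n m = y' m)"
proof -
  \<comment> \<open>Clustering over the product alphabet makes both sequences approach their limits
    along the same indices.\<close>
  obtain z where z: "\<forall>F N. finite F \<longrightarrow> (\<exists>n\<ge>N. \<forall>m\<in>F. (x n m, y n m) = z m)"
    using cluster_point[of "\<lambda>n m. (x n m, y n m)"] by blast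
  define x' y' where "x' = fst \<circ> z" and "y' = snd \<circ> z"
  have *: "\<exists>n\<ge>N. \<forall>m\<in>F. x n m = x' m \<and> y n m = y' m" if "finite F" for F N
    using z[rule_format, OF that, of N] unfolding x'_def y'_def
    by (simp add: prod_eq_iff)
  show ?thesis
  proof (rule bexI[of _ x'], rule bexI[of _ y'])
    show "\<forall>F N. finite F \<longrightarrow> (\<exists>n\<ge>N. \<forall>m\<in>F. x n m = x' m \<and> y n m = y' m)"
      using * by simp
    show "y' \<in> X"
    proof (rule closed)
      fix F :: "(int ^ 'd) set"
      assume "finite F"
      from *[OF this, of 0] obtain n where "\<forall>m\<in>F. x n m = x' m \<and> y n m = y' m"
        by auto
      then show "\<exists>y\<in>X. \<forall>m\<in>F. y m = y' m"
        using assms(2)[of n] by (intro bexI[of _ "y n"]) auto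
    qed
    show "x' \<in> X"
    proof (rule closed)
      fix F :: "(int ^ 'd) set"
      assume "finite F"
      from *[OF this, of 0] obtain n where "\<forall>m\<in>F. x n m = x' m \<and> y n m = y' m"
        by auto
      then show "\<exists>y\<in>X. \<forall>m\<in>F. y m = x' m"
        using assms(1)[of n] by (intro bexI[of _ "x n"]) auto
    qed
  qed
qed

text \<open>The compactness half of the Curtis-Hedlund-Lyndon theorem: if every cube failed,
  continuity of \<open>f\<close> at a cluster point would be violated. The window is recorded at
  position 0; the intertwining relation later carries it to other positions.\<close>

lemma local_rule:
  assumes "continuous_map (subtopology full_shift_topology X) (subtopology full_shift_topology X) f"
  obtains r where "r \<ge> 0" "\<And>x y. x \<in> X \<Longrightarrow> y \<in> X \<Longrightarrow> (\<forall>m\<in>cube r. x m = y m) \<Longrightarrow> f x 0 = f y 0"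
proof -
  have "\<exists>r\<ge>0. \<forall>x\<in>X. \<forall>y\<in>X. (\<forall>m\<in>cube r. x m = y m) \<longrightarrow> f x 0 = f y 0"
  proof (rule ccontr)
    assume "\<not> ?thesis"
    then have "\<forall>n::nat. \<exists>x y. x \<in> X \<and> y \<in> X \<and> (\<forall>m\<in>cube (int n). x m = y m) \<and> f x 0 \<noteq> f y 0"
      using of_nat_0_le_iff by blast
    then obtain x y where "\<forall>n. x n \<in> X \<and> y n \<in> X \<and> (\<forall>m\<in>cube (int n). x n m = y n m) \<and> f (x n) 0 \<noteq> f (y n) 0"
      by metis
    then have xy: "\<And>n. x n \<in> X" "\<And>n. y n \<in> X"
      "\<And>n m. m \<in> cube (int n) \<Longrightarrow> x n m = y n m" "\<And>n. f (x n) 0 \<noteq> f (y n) 0"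
      by blast+
    obtain x' y' where x'y': "x' \<in> X" "y' \<in> X"
      "\<And>F N. finite F \<Longrightarrow> \<exists>n\<ge>N. \<forall>m\<in>F. x n m = x' m \<and> y n m = y' m"
      using cluster_pair[of x y, OF xy(1,2)] by blast
    obtain F where F: "finite F" "\<forall>y\<in>X. (\<forall>k\<in>F. y k = x' k) \<longrightarrow> f y 0 = f x' 0"
      using continuous_map_full_shift_local[OF assms x'y'(1)] by blast
    obtain r where r: "F \<subseteq> cube r"
      by (rule finite_subset_cube[OF F(1)]) blast
    obtain n where n: "n \<ge> nat r" "\<forall>m\<in>F. x n m = x' m"
      using x'y'(3)[OF F(1), of "nat r"] by blast
    have "cube r \<subseteq> cube (int n)"
      using n(1) by (intro cube_mono) linarith
    then have "y n m = x' m" if "m \<in> F" for m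
      using n(2) that xy(3)[of m n] r by auto
    then have "f (y n) 0 = f x' 0" "f (x n) 0 = f x' 0"
      using F(2) n(2) xy(1,2) by auto
    then show False
      using xy(4)[of n] by simp
  qed
  then show thesis
    using that by blast
qed

text \<open>If every cube failed, the cluster points would have equal images but different letters
  at 0, against injectivity. This is the window of the inverse map, obtained before its continuity
  is known.\<close>

lemma inverse_local_rule:
  assumes f: "continuous_map (subtopology full_shift_topology X) (subtopology full_shift_topology X) f"
    and inj: "inj_on f X"
  obtains r where "r \<ge> 0" "\<And>x y. x \<in> X \<Longrightarrow> y \<in> X \<Longrightarrow> (\<forall>m\<in>cube r. f x m = f y m) \<Longrightarrow> x 0 = y 0"
proof -
  have "\<exists>r\<ge>0. \<forall>x\<in>X. \<forall>y\<in>X. (\<forall>m\<in>cube r. f x m = f y m) \<longrightarrow> x 0 = y 0"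
  proof (rule ccontr)
    assume "\<not> ?thesis"
    then have "\<forall>n::nat. \<exists>x y. x \<in> X \<and> y \<in> X \<and> (\<forall>m\<in>cube (int n). f x m = f y m) \<and> x 0 \<noteq> y 0"
      using of_nat_0_le_iff by blast
    then obtain x y where "\<forall>n. x n \<in> X \<and> y n \<in> X \<and> (\<forall>m\<in>cube (int n). f (x n) m = f (y n) m) \<and> x n 0 \<noteq> y n 0"
      by metis
    then have xy: "\<And>n. x n \<in> X" "\<And>n. y n \<in> X"
      "\<And>n m. m \<in> cube (int n) \<Longrightarrow> f (x n) m = f (y n) m" "\<And>n. x n 0 \<noteq> y n 0"
      by blast+
    obtain x' y' where x'y': "x' \<in> X" "y' \<in> X"
      "\<And>F N. finite F \<Longrightarrow> \<exists>n\<ge>N. \<forall>m\<in>F. x n m = x' m \<and> y n m = y' m"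
      using cluster_pair[of x y, OF xy(1,2)] by blast
    have "f x' m = f y' m" for m
    proof -
      obtain F where F: "finite F" "\<forall>y\<in>X. (\<forall>k\<in>F. y k = x' k) \<longrightarrow> f y m = f x' m"
        using continuous_map_full_shift_local[OF f x'y'(1)] by blast
      obtain G where G: "finite G" "\<forall>y\<in>X. (\<forall>k\<in>G. y k = y' k) \<longrightarrow> f y m = f y' m"
        using continuous_map_full_shift_local[OF f x'y'(2)] by blast
      obtain r where r: "{m} \<subseteq> cube r"
        using finite_subset_cube[of "{m}"] by auto
      obtain n where n: "n \<ge> nat r" "\<forall>m\<in>F \<union> G. x n m = x' m \<and> y n m = y' m"
        using x'y'(3)[of "F \<union> G" "nat r"] F(1) G(1) by auto
      have "cube r \<subseteq> cube (int n)"
        using n(1) by (intro cube_mono) linarith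
      then have "f (x n) m = f (y n) m"
        using xy(3)[of m n] r by auto
      moreover have "f (x n) m = f x' m" "f (y n) m = f y' m"
        using F(2) G(2) n(2) xy(1,2) by auto
      ultimately show ?thesis
        by simp
    qed
    then have "x' = y'"
      using inj x'y'(1,2) by (auto dest: inj_onD)
    then show False
      using x'y'(3)[of "{0}" 0] xy(4) by (metis finite.emptyI finite.insertI singletonI)
  qed
  then show thesis
    using that by blast
qed

end

section \<open>Blocks and addresses\<close>

text \<open>Index of the box containing \<open>m\<close> in the grid of boxes with sides
  \<open>l\<close> and a corner at 0.\<close>

definition vdiv :: "int ^ 'd \<Rightarrow> int ^ 'd \<Rightarrow> int ^ 'd" where
  "vdiv m l = (\<chi> i. m $ i div l $ i)"

lemma vdiv_nth [simp]: "vdiv m l $ i = m $ i div l $ i"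
  by (simp add: vdiv_def)

lemma side_power_nth [simp]: "side_power s n $ i = s $ i ^ n"
  by (simp add: side_power_def)

text \<open>The substitution \<open>\<theta>\<^sup>n\<close> acting on configurations, with block 0
  placed at the origin.\<close>

definition inflate :: "int ^ 'd \<Rightarrow> ('a \<Rightarrow> int ^ 'd \<Rightarrow> 'a) \<Rightarrow> nat \<Rightarrow> (int ^ 'd \<Rightarrow> 'a) \<Rightarrow> int ^ 'd \<Rightarrow> 'a" where
  "inflate s \<theta> n x = (\<lambda>m. subst_iter s \<theta> n (x (vdiv m (side_power s n))) m)"

text \<open>
  \<open>aligned s \<theta> n g x q\<close>: the block of \<open>x\<close> with index \<open>q\<close>, in the grid of level \<open>n\<close> translated by
  \<open>- g\<close>, is \<open>\<theta>\<^sup>n(a)\<close> for some \<open>a\<close>. The position \<open>m + g\<close> need not be reduced to the box, since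
  \<^term>\<open>subst_iter s \<theta> n a\<close> is periodic with periods \<open>s\<^sup>n\<close>.
\<close>

definition aligned :: "int ^ 'd \<Rightarrow> ('a \<Rightarrow> int ^ 'd \<Rightarrow> 'a) \<Rightarrow> nat \<Rightarrow> int ^ 'd \<Rightarrow> (int ^ 'd \<Rightarrow> 'a) \<Rightarrow> int ^ 'd \<Rightarrow> bool" where
  "aligned s \<theta> n g x q \<longleftrightarrow>
     (\<exists>a. \<forall>m. vdiv (m + g) (side_power s n) = q \<longrightarrow> x m = subst_iter s \<theta> n a (m + g))"

text \<open>Offsets are kept as residues modulo the block sides. This makes the sets finite and lets
  addresses be counted.\<close>

definition addresses :: "int ^ 'd \<Rightarrow> ('a \<Rightarrow> int ^ 'd \<Rightarrow> 'a) \<Rightarrow> nat \<Rightarrow> (int ^ 'd \<Rightarrow> 'a) \<Rightarrow> (int ^ 'd) set" where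
  "addresses s \<theta> n x = {g \<in> box_support (side_power s n). \<forall>q. aligned s \<theta> n g x q}"

lemma finite_box_support: "finite (box_support l)"
  using finite_vec_box[of "\<lambda>i. {0..<l $ i}"] by (simp add: box_support_def)

locale rect_subst =
  fixes s :: "int ^ 'd" and \<theta> :: "'a::finite \<Rightarrow> int ^ 'd \<Rightarrow> 'a"
  assumes nontrivial: "nontrivial_subst s"
    and primitive: "primitive_subst s \<theta>"
    and bijective: "bijective_subst s \<theta>"
begin

abbreviation L :: "nat \<Rightarrow> int ^ 'd" where "L \<equiv> side_power s"
abbreviation \<Theta> :: "nat \<Rightarrow> 'a \<Rightarrow> int ^ 'd \<Rightarrow> 'a" where "\<Theta> \<equiv> subst_iter s \<theta>"
abbreviation T :: "nat \<Rightarrow> (int ^ 'd \<Rightarrow> 'a) \<Rightarrow> int ^ 'd \<Rightarrow> 'a" where "T \<equiv> inflate s \<theta>"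
abbreviation X :: "(int ^ 'd \<Rightarrow> 'a) set" where "X \<equiv> minimal_subshift s \<theta>"
abbreviation addr :: "nat \<Rightarrow> (int ^ 'd \<Rightarrow> 'a) \<Rightarrow> (int ^ 'd) set" where "addr \<equiv> addresses s \<theta>"

section \<open>Nested grids and iterated substitutions\<close>

lemma s_gt_1: "s $ i > 1"
  using nontrivial by (simp add: nontrivial_subst_def)

lemma s_pow_pos: "s $ i ^ n > 0"
  using s_gt_1[of i] by simp

lemma s_nonzero: "s $ i \<noteq> 0"
  using s_gt_1[of i] by simp

lemma s_pow_ge: "s $ i ^ n \<ge> 2 ^ n"
  using s_gt_1[of i] by (intro power_mono) auto

lemma vdiv_add: "vdiv (m + L n * p) (L n) = vdiv m (L n) + p"
  by (simp add: vec_eq_iff s_nonzero)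

lemma vdiv_L_0 [simp]: "vdiv m (L 0) = m"
  by (simp add: vec_eq_iff)

lemma vdiv_zero [simp]: "vdiv 0 (L n) = 0"
  by (simp add: vec_eq_iff)

lemma vdiv_vdiv: "vdiv (vdiv m (L a)) (L b) = vdiv m (L (a + b))"
  using s_pow_pos by (simp add: vec_eq_iff power_add less_imp_le zdiv_zmult2_eq)

lemma vdiv_eq_iff: "vdiv m (L n) = q \<longleftrightarrow> (\<forall>i. q $ i * s $ i ^ n \<le> m $ i \<and> m $ i < (q $ i + 1) * s $ i ^ n)"
proof -
  have "a div l = b \<longleftrightarrow> b * l \<le> a \<and> a < (b + 1) * l" if "l > 0" for a b l :: int
  proof
    assume "a div l = b"
    then have "a = l * b + a mod l" "0 \<le> a mod l" "a mod l < l"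
      using that by auto
    then show "b * l \<le> a \<and> a < (b + 1) * l"
      by (simp add: algebra_simps)
  next
    assume *: "b * l \<le> a \<and> a < (b + 1) * l"
    then show "a div l = b"
      by (intro int_div_pos_eq[of a l b "a - b * l"]) (auto simp: algebra_simps)
  qed
  then show ?thesis
    by (simp add: vec_eq_iff s_pow_pos)
qed

lemma box_support_iff: "m \<in> box_support (L n) \<longleftrightarrow> vdiv m (L n) = 0"
  by (simp add: vdiv_eq_iff box_support_def)

lemma finite_block: "finite {m. vdiv (m + g) (L n) = q}"
proof -
  have "{m. vdiv (m + g) (L n) = q} \<subseteq>
      {m. \<forall>i. m $ i \<in> {q $ i * s $ i ^ n - g $ i ..< (q $ i + 1) * s $ i ^ n - g $ i}}"
    unfolding vdiv_eq_iff by (auto simp: algebra_simps)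
  then show ?thesis
    by (rule finite_subset) (rule finite_vec_box, simp)
qed

lemma vec_mod_in_box: "v - L n * vdiv v (L n) \<in> box_support (L n)"
  using vdiv_add[of v n "- vdiv v (L n)"] by (simp add: box_support_iff)

lemma subst_iter_Suc: "\<Theta> (Suc n) a m = \<theta> (\<Theta> n a (vdiv m s)) (\<chi> i. m $ i mod s $ i)"
  by (simp add: vdiv_def)

text \<open>The first \<open>k\<close> levels select the letter of the block containing
  \<open>m\<close>, and the last \<open>n\<close> levels expand it.\<close>

lemma subst_iter_add: "\<Theta> (k + n) a m = \<Theta> n (\<Theta> k a (vdiv m (L n))) m"
proof (induction n arbitrary: m)
  case (Suc n)
  have "vdiv (vdiv m s) (L n) = vdiv m (L (Suc n))"
    using vdiv_vdiv[of m 1 n] by (simp add: side_power_def)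
  then show ?case
    using Suc[of "vdiv m s"] by (simp only: add_Suc_right subst_iter_Suc)
qed simp

lemma subst_iter_periodic: "\<Theta> n a (m + L n * p) = \<Theta> n a m"
proof (induction n arbitrary: m)
  case (Suc n)
  have "vdiv (m + L (Suc n) * p) s = vdiv m s + L n * p"
    by (simp add: vec_eq_iff mult.assoc s_nonzero)
  moreover have "(\<chi> i. (m + L (Suc n) * p) $ i mod s $ i) = (\<chi> i. m $ i mod s $ i)"
    by (simp add: vec_eq_iff mult.assoc)
  ultimately show ?case
    using Suc[of "vdiv m s"] by (simp only: subst_iter_Suc)
qed simp

text \<open>Each position of an iterate is reached through a composition of columns of \<theta>, all
  injective by bijectivity. Thus a single letter of a block determines the block.\<close>

lemma subst_iter_inj: "\<Theta> n a m = \<Theta> n b m \<longleftrightarrow> a = b"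
proof (induction n arbitrary: m)
  case (Suc n)
  have "(\<chi> i. m $ i mod s $ i) \<in> box_support s"
    using s_gt_1 by (simp add: box_support_def order_less_trans[OF zero_less_one])
  then have "inj (\<lambda>a. \<theta> a (\<chi> i. m $ i mod s $ i))"
    using bijective unfolding bijective_subst_def by (blast dest: bij_is_inj)
  then show ?case
    using Suc[of "vdiv m s"] unfolding subst_iter_Suc by (auto dest: injD)
qed simp

lemma inflate_shift: "T n (shift p x) = shift (L n * p) (T n x)"
proof
  fix m
  have "vdiv (m - L n * p) (L n) = vdiv m (L n) - p"
    using vdiv_add[of m n "- p"] by simp
  then show "T n (shift p x) m = shift (L n * p) (T n x) m"
    using subst_iter_periodic[of n _ m "- p"] by (simp add: inflate_def)
qed

section \<open>Patterns, repetitivity and existence of addresses\<close>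

lemma minimal_subshift_iff:
  "x \<in> X \<longleftrightarrow> (\<forall>U. finite U \<longrightarrow>
     (\<exists>k\<ge>1. \<exists>a v. \<forall>u\<in>U. vdiv (u + v) (L k) = 0 \<and> \<Theta> k a (u + v) = x u))"
  by (simp add: minimal_subshift_def box_support_iff)

sublocale closed_subshift X
proof
  fix x p assume x: "x \<in> X"
  show "shift p x \<in> X"
    unfolding minimal_subshift_iff
  proof (intro allI impI)
    fix U :: "(int ^ 'd) set" assume "finite U"
    then have "finite ((\<lambda>u. u - p) ` U)"
      by simp
    then obtain k a v where k: "k \<ge> 1"
      and *: "\<forall>u\<in>(\<lambda>u. u - p) ` U. vdiv (u + v) (L k) = 0 \<and> \<Theta> k a (u + v) = x u"
      using x unfolding minimal_subshift_iff by metis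
    have "\<forall>u\<in>U. vdiv (u + (v - p)) (L k) = 0 \<and> \<Theta> k a (u + (v - p)) = shift p x u"
    proof
      fix u assume "u \<in> U"
      then have "vdiv (u - p + v) (L k) = 0 \<and> \<Theta> k a (u - p + v) = x (u - p)"
        using * by blast
      moreover have "u - p + v = u + (v - p)"
        by simp
      ultimately show "vdiv (u + (v - p)) (L k) = 0 \<and> \<Theta> k a (u + (v - p)) = shift p x u"
        by (simp only: shift_apply)
    qed
    then show "\<exists>k\<ge>1. \<exists>a v. \<forall>u\<in>U. vdiv (u + v) (L k) = 0 \<and> \<Theta> k a (u + v) = shift p x u"
      using k by blast
  qed
next
  fix x assume *: "\<And>F. finite F \<Longrightarrow> \<exists>y\<in>X. \<forall>m\<in>F. y m = x m"
  show "x \<in> X"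
    unfolding minimal_subshift_iff
  proof (intro allI impI)
    fix U :: "(int ^ 'd) set" assume U: "finite U"
    then obtain y where y: "y \<in> X" "\<forall>m\<in>U. y m = x m"
      using * by blast
    obtain k a v where "k \<ge> 1" "\<forall>u\<in>U. vdiv (u + v) (L k) = 0 \<and> \<Theta> k a (u + v) = y u"
      using y(1) U unfolding minimal_subshift_iff by metis
    then show "\<exists>k\<ge>1. \<exists>a v. \<forall>u\<in>U. vdiv (u + v) (L k) = 0 \<and> \<Theta> k a (u + v) = x u"
      using y(2) by (intro exI[of _ k] conjI exI[of _ a] exI[of _ v]) simp_all
  qed
qed

text \<open>A pattern of \<open>x\<close> inside \<open>\<Theta> k a\<close> at \<open>v\<close>
  becomes, after \<open>n\<close> more substitutions, a pattern of \<open>T n x\<close> inside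
  \<open>\<Theta> (k + n) a\<close> at \<open>L n * v\<close>.\<close>

lemma inflate_in:
  assumes x: "x \<in> X"
  shows "T n x \<in> X"
  unfolding minimal_subshift_iff
proof (intro allI impI)
  fix U :: "(int ^ 'd) set" assume "finite U"
  then have "finite ((\<lambda>u. vdiv u (L n)) ` U)"
    by simp
  then obtain k a v where k: "k \<ge> 1"
    and *: "\<forall>u\<in>(\<lambda>u. vdiv u (L n)) ` U. vdiv (u + v) (L k) = 0 \<and> \<Theta> k a (u + v) = x u"
    using x unfolding minimal_subshift_iff by metis
  have "\<forall>u\<in>U. vdiv (u + L n * v) (L (k + n)) = 0 \<and> \<Theta> (k + n) a (u + L n * v) = T n x u"
  proof
    fix u assume "u \<in> U"
    then have u: "vdiv (vdiv u (L n) + v) (L k) = 0" "\<Theta> k a (vdiv u (L n) + v) = x (vdiv u (L n))"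
      using * by blast+
    have "vdiv (u + L n * v) (L (k + n)) = 0"
      using u(1) by (simp only: vdiv_vdiv[symmetric] add.commute[of k n] vdiv_add)
    moreover have "\<Theta> (k + n) a (u + L n * v) = T n x u"
      by (simp only: subst_iter_add subst_iter_periodic vdiv_add u(2) inflate_def)
    ultimately show "vdiv (u + L n * v) (L (k + n)) = 0 \<and> \<Theta> (k + n) a (u + L n * v) = T n x u" ..
  qed
  moreover have "k + n \<ge> 1"
    using k by simp
  ultimately show "\<exists>k\<ge>1. \<exists>a v. \<forall>u\<in>U. vdiv (u + v) (L k) = 0 \<and> \<Theta> k a (u + v) = T n x u"
    by blast
qed

text \<open>The last \<open>M\<close> substitutions expand the letter at the origin of
  \<open>\<Theta> n a\<close> into a block that contains every letter.\<close>

lemma primitive_large: "\<exists>N\<ge>n. \<forall>a b. \<exists>m. vdiv m (L N) = 0 \<and> \<Theta> N a m = b"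
proof -
  obtain M where M: "\<And>a b. \<exists>m. vdiv m (L M) = 0 \<and> \<Theta> M a m = b"
    using primitive by (auto simp: primitive_subst_def box_support_iff Bex_def)
  have "\<exists>m. vdiv m (L (n + M)) = 0 \<and> \<Theta> (n + M) a m = b" for a b
  proof -
    obtain m where m: "vdiv m (L M) = 0" "\<Theta> M (\<Theta> n a 0) m = b"
      using M by blast
    have "vdiv m (L (n + M)) = 0"
      by (simp only: add.commute[of n M] vdiv_vdiv[symmetric] m(1) vdiv_zero)
    moreover have "\<Theta> (n + M) a m = b"
      by (simp only: subst_iter_add m)
    ultimately have "vdiv m (L (n + M)) = 0 \<and> \<Theta> (n + M) a m = b" ..
    then show ?thesis ..
  qed
  then show ?thesis
    by (intro exI[of _ "n + M"]) simp
qed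

text \<open>Primitivity frees the seed letter: the letter \<open>a\<close> whose iterate shows the
  pattern occurs in \<open>\<Theta> N b\<close> for every \<open>b\<close>, and one level
  \<open>N + k\<close> serves all \<open>b\<close>.\<close>

lemma pattern_in_every_iterate:
  assumes x: "x \<in> X" and U: "finite U"
  shows "\<exists>k\<ge>n. \<forall>b. \<exists>v. \<forall>u\<in>U. vdiv (u + v) (L k) = 0 \<and> \<Theta> k b (u + v) = x u"
proof -
  obtain k a v where v: "\<forall>u\<in>U. vdiv (u + v) (L k) = 0 \<and> \<Theta> k a (u + v) = x u"
    using x U unfolding minimal_subshift_iff by metis
  obtain N where N: "N \<ge> n" "\<And>a b. \<exists>m. vdiv m (L N) = 0 \<and> \<Theta> N a m = b"
    using primitive_large by metis
  have "\<exists>v. \<forall>u\<in>U. vdiv (u + v) (L (N + k)) = 0 \<and> \<Theta> (N + k) b (u + v) = x u" for b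
  proof -
    obtain w where w: "vdiv w (L N) = 0" "\<Theta> N b w = a"
      using N(2) by blast
    have "vdiv (u + (v + L k * w)) (L (N + k)) = 0 \<and> \<Theta> (N + k) b (u + (v + L k * w)) = x u" if "u \<in> U" for u
    proof -
      have u: "vdiv (u + v + L k * w) (L k) = w" "\<Theta> k a (u + v) = x u"
        using v that by (simp_all add: vdiv_add)
      have "vdiv (u + v + L k * w) (L (N + k)) = 0"
        by (simp only: add.commute[of N k] vdiv_vdiv[symmetric] u w)
      moreover have "\<Theta> (N + k) b (u + v + L k * w) = x u"
        by (simp only: subst_iter_add u w subst_iter_periodic)
      ultimately show ?thesis
        by (simp only: add.assoc)
    qed
    then show ?thesis by blast
  qed
  then show ?thesis
    using N(1) by (intro exI[of _ "N + k"]) simp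
qed

text \<open>There are finitely many offsets. If each failed at some block, the finite union of these
  blocks would occur inside one large iterate, whose own grid of level \<open>n\<close> gives an
  offset that does not fail.\<close>

lemma addresses_nonempty:
  assumes x: "x \<in> X"
  shows "addr n x \<noteq> {}"
proof
  assume "addr n x = {}"
  then have "\<forall>g\<in>box_support (L n). \<exists>q. \<not> aligned s \<theta> n g x q"
    by (auto simp: addresses_def)
  then obtain q where q: "\<forall>g\<in>box_support (L n). \<not> aligned s \<theta> n g x (q g)"
    by metis
  define U where "U = (\<Union>g\<in>box_support (L n). {m. vdiv (m + g) (L n) = q g})"
  have "finite U"
    unfolding U_def by (intro finite_UN_I finite_box_support finite_block)
  then obtain k b v where k: "k \<ge> n" and v: "\<forall>u\<in>U. vdiv (u + v) (L k) = 0 \<and> \<Theta> k b (u + v) = x u"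
    using pattern_in_every_iterate[OF x] by metis
  define w where "w = vdiv v (L n)"
  define g where "g = v - L n * w"
  have g: "g \<in> box_support (L n)"
    unfolding g_def w_def by (rule vec_mod_in_box)
  have "x m = \<Theta> n (\<Theta> (k - n) b (q g + w)) (m + g)" if m: "vdiv (m + g) (L n) = q g" for m
  proof -
    have "m \<in> U"
      using m g by (auto simp: U_def)
    then have "x m = \<Theta> ((k - n) + n) b (m + v)"
      using v k by simp
    also have "m + v = m + g + L n * w"
      by (simp add: g_def)
    finally show ?thesis
      by (simp only: subst_iter_add subst_iter_periodic vdiv_add m)
  qed
  then have "aligned s \<theta> n g x (q g)"
    unfolding aligned_def by blast
  with q g show False
    by blast
qed

text \<open>At level \<open>k\<close> the iterate of every letter contains the pattern. So the block
  of \<open>y\<close> around \<open>c\<close>, whatever its letter, contains it, and the block sides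
  bound the distance uniformly in \<open>y\<close> and \<open>c\<close>.\<close>

lemma repetitive:
  assumes x: "x \<in> X" and F: "finite F"
  shows "\<exists>R\<ge>0. \<forall>y\<in>X. \<forall>c. \<exists>p. (\<forall>m\<in>F. m + p - c \<in> cube R) \<and> (\<forall>m\<in>F. y (m + p) = x m)"
proof -
  obtain k where k: "\<And>b. \<exists>v. \<forall>u\<in>F. vdiv (u + v) (L k) = 0 \<and> \<Theta> k b (u + v) = x u"
    using pattern_in_every_iterate[OF assms] by metis
  obtain R where R: "R \<ge> 0" "{L k} \<subseteq> cube R"
    by (rule finite_subset_cube[of "{L k}"]) simp_all
  have "\<exists>p. (\<forall>m\<in>F. m + p - c \<in> cube R) \<and> (\<forall>m\<in>F. y (m + p) = x m)" if y: "y \<in> X" for y c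
  proof -
    obtain g where "g \<in> addr k y"
      using addresses_nonempty[OF y] by blast
    define q where "q = vdiv (c + g) (L k)"
    obtain a where a: "\<And>m. vdiv (m + g) (L k) = q \<Longrightarrow> y m = \<Theta> k a (m + g)"
      using \<open>g \<in> addr k y\<close> unfolding addresses_def aligned_def by blast
    obtain v where v: "\<forall>u\<in>F. vdiv (u + v) (L k) = 0 \<and> \<Theta> k a (u + v) = x u"
      using k by blast
    define p where "p = v + L k * q - g"
    have "y (m + p) = x m \<and> m + p - c \<in> cube R" if "m \<in> F" for m
    proof
      have *: "m + p + g = m + v + L k * q"
        by (simp add: p_def)
      have **: "vdiv (m + p + g) (L k) = q"
        using v that by (simp only: * vdiv_add) simp
      then show "y (m + p) = x m"
        using a v that by (simp add: * subst_iter_periodic)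
      show "m + p - c \<in> cube R"
        unfolding cube_def
      proof (intro CollectI allI)
        fix i
        have "q $ i * s $ i ^ k \<le> (m + p + g) $ i" "(m + p + g) $ i < (q $ i + 1) * s $ i ^ k"
             "q $ i * s $ i ^ k \<le> (c + g) $ i" "(c + g) $ i < (q $ i + 1) * s $ i ^ k"
          using ** q_def vdiv_eq_iff by metis+
        then have "\<bar>(m + p - c) $ i\<bar> \<le> s $ i ^ k"
          by (simp add: algebra_simps abs_le_iff)
        also have "\<dots> \<le> R"
          using R(2) by (auto simp: cube_def abs_le_iff)
        finally show "\<bar>(m + p - c) $ i\<bar> \<le> R" .
      qed
    qed
    then show ?thesis
      by (intro exI[of _ p]) simp
  qed
  with R(1) show ?thesis
    by blast
qed

text \<open>
  The addresses compatible with \<open>x\<close> on the agreement set \<open>D\<close> contain those of \<open>x\<close>; recurrence of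
  the patterns of \<open>x\<close> inside \<open>D\<close> translates them injectively into addresses of \<open>x\<close>, so by counting
  the two sets coincide.
\<close>

lemma addresses_relative:
  assumes x: "x \<in> X" and D: "\<And>r. \<exists>c. \<forall>m\<in>cube r. c + m \<in> D"
  shows "addr n x = {g \<in> box_support (L n). \<forall>q. {m. vdiv (m + g) (L n) = q} \<subseteq> D \<longrightarrow> aligned s \<theta> n g x q}"
    (is "_ = ?E")
proof -
  have "finite ?E"
    by (rule finite_subset[OF _ finite_box_support]) auto
  have sub: "addr n x \<subseteq> ?E"
    by (auto simp: addresses_def)
  have "\<forall>g\<in>box_support (L n) - addr n x. \<exists>q. \<not> aligned s \<theta> n g x q"
    by (auto simp: addresses_def)
  then obtain q where q: "\<forall>g\<in>box_support (L n) - addr n x. \<not> aligned s \<theta> n g x (q g)"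
    by metis
  \<comment> \<open>\<open>F\<close> contains a misaligned block for each offset outside
    \<open>addr n x\<close>. A recurrence of this finite pattern inside \<open>D\<close> transports
    all these failures into \<open>D\<close>.\<close>
  define F where "F = (\<Union>g\<in>box_support (L n). {m. vdiv (m + g) (L n) = q g})"
  have F: "finite F"
    unfolding F_def by (intro finite_UN_I finite_box_support finite_block)
  obtain R where R: "\<And>c. \<exists>p. (\<forall>m\<in>F. m + p - c \<in> cube R) \<and> (\<forall>m\<in>F. x (m + p) = x m)"
    using repetitive[OF x F] x by blast
  obtain c where c: "\<forall>m\<in>cube R. c + m \<in> D"
    using D by blast
  obtain p where p: "\<forall>m\<in>F. m + p - c \<in> cube R" "\<forall>m\<in>F. x (m + p) = x m"
    using R by blast
  have pD: "m + p \<in> D" if "m \<in> F" for m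
    using c p(1) that by force
  \<comment> \<open>Translation of the grid by \<open>p\<close>, with the offset reduced modulo the
    block sides.\<close>
  define \<phi> where "\<phi> = (\<lambda>g. g + p - L n * vdiv (g + p) (L n))"
  have "inj_on \<phi> ?E"
  proof (rule inj_onI)
    fix g h assume g: "g \<in> ?E" and h: "h \<in> ?E" and "\<phi> g = \<phi> h"
    then have "g = h + L n * (vdiv (g + p) (L n) - vdiv (h + p) (L n))" (is "_ = _ + _ * ?w")
      by (simp add: \<phi>_def algebra_simps)
    moreover have "vdiv g (L n) = 0" "vdiv h (L n) = 0"
      using g h by (auto simp: box_support_iff)
    ultimately have "?w = 0"
      by (metis vdiv_add add_0)
    then show "g = h"
      using \<open>g = h + L n * ?w\<close> by simp
  qed
  moreover have "\<phi> ` ?E \<subseteq> addr n x"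
  proof
    fix g' assume "g' \<in> \<phi> ` ?E"
    then obtain g where g: "g \<in> ?E" and g': "g' = \<phi> g"
      by blast
    define w where "w = vdiv (g + p) (L n)"
    have gw: "g + p = g' + L n * w"
      by (simp add: g' \<phi>_def w_def)
    have box: "g' \<in> box_support (L n)"
      unfolding g' \<phi>_def by (rule vec_mod_in_box)
    show "g' \<in> addr n x"
    proof (rule ccontr)
      assume "g' \<notin> addr n x"
      then have nal: "\<not> aligned s \<theta> n g' x (q g')"
        using q box by blast
      have blk: "m \<in> F" if "vdiv (m + g') (L n) = q g'" for m
        using that box by (auto simp: F_def)
      have shifted: "m + p + g = m + g' + L n * w" for m
        using gw by (simp add: algebra_simps)
      \<comment> \<open>The translate by \<open>p\<close> of the misaligned block of
        \<open>g'\<close> is a block of the grid of \<open>g\<close>. It lies in \<open>D\<close>,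
        where \<open>g\<close> is known to be aligned.\<close>
      have "{m. vdiv (m + g) (L n) = q g' + w} \<subseteq> D"
      proof
        fix m assume "m \<in> {m. vdiv (m + g) (L n) = q g' + w}"
        moreover have "(m - p) + g' + L n * w = m + g"
          using gw by (simp add: algebra_simps)
        ultimately have "vdiv ((m - p) + g' + L n * w) (L n) = q g' + w"
          by (simp only: mem_Collect_eq)
        then have "vdiv ((m - p) + g') (L n) = q g'"
          by (simp only: vdiv_add) simp
        then show "m \<in> D"
          using pD[OF blk, of "m - p"] by simp
      qed
      then have "aligned s \<theta> n g x (q g' + w)"
        using g by blast
      then obtain a where a: "\<And>m. vdiv (m + g) (L n) = q g' + w \<Longrightarrow> x m = \<Theta> n a (m + g)"
        unfolding aligned_def by blast
      have "x m = \<Theta> n a (m + g')" if m: "vdiv (m + g') (L n) = q g'" for m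
      proof -
        have "x m = x (m + p)"
          using p(2) blk[OF m] by simp
        also have "\<dots> = \<Theta> n a (m + p + g)"
          by (rule a) (simp add: shifted vdiv_add m)
        finally show ?thesis
          by (simp add: shifted subst_iter_periodic)
      qed
      then show False
        using nal unfolding aligned_def by blast
    qed
  qed
  moreover have "finite (addr n x)"
    using sub \<open>finite ?E\<close> by (rule finite_subset)
  ultimately have "card ?E \<le> card (addr n x)"
    by (intro card_inj_on_le)
  then show ?thesis
    using card_seteq[OF \<open>finite ?E\<close> sub] by simp
qed

text \<open>With \<open>D\<close> the agreement set, the right-hand side of
  \<open>addresses_relative\<close> only inspects blocks on which \<open>x\<close> and
  \<open>y\<close> coincide.\<close>

lemma addresses_eq:
  assumes "x \<in> X" "y \<in> X" and agree: "\<And>r. \<exists>c. \<forall>m\<in>cube r. x (c + m) = y (c + m)"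
  shows "addr n x = addr n y"
proof -
  define D where "D = {m. x m = y m}"
  have D: "\<exists>c. \<forall>m\<in>cube r. c + m \<in> D" for r
    using agree by (simp add: D_def)
  have "aligned s \<theta> n g x q \<longleftrightarrow> aligned s \<theta> n g y q" if "{m. vdiv (m + g) (L n) = q} \<subseteq> D" for g q
  proof -
    have "x m = y m" if "vdiv (m + g) (L n) = q" for m
      using that \<open>_ \<subseteq> D\<close> by (auto simp: D_def)
    then show ?thesis
      unfolding aligned_def by auto
  qed
  then show ?thesis
    unfolding addresses_relative[OF assms(1) D] addresses_relative[OF assms(2) D] by auto
qed

end

section \<open>Asymptotic pairs and monomial matrices\<close>

text \<open>With one entry per row, the sums in \<open>A ** B\<close> collapse to single products:
  the diagonal ones force the entries of \<open>A\<close> to be units, the others force their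
  positions \<rho> to be injective.\<close>

lemma monomial_rows_hyperoctahedral:
  fixes A B :: "int ^ 'd ^ 'd"
  assumes AB: "A ** B = mat 1"
    and mono: "\<And>i j k. A $ i $ j \<noteq> 0 \<Longrightarrow> A $ i $ k \<noteq> 0 \<Longrightarrow> j = k"
  shows "A \<in> hyperoctahedral"
proof -
  have AB': "(\<Sum>k\<in>UNIV. A $ i $ k * B $ k $ j) = (if i = j then 1 else 0)" for i j
    using AB by (simp add: vec_eq_iff matrix_matrix_mult_def mat_def)
  have "\<exists>j. A $ i $ j \<noteq> 0" for i
  proof (rule ccontr)
    assume "\<not> ?thesis"
    then show False
      using AB'[of i i] by simp
  qed
  then obtain \<rho> where \<rho>: "\<And>i. A $ i $ \<rho> i \<noteq> 0"
    by metis
  have zero: "A $ i $ k = 0" if "k \<noteq> \<rho> i" for i k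
    using mono[of i k "\<rho> i"] \<rho>[of i] that by blast
  have prod: "A $ i $ \<rho> i * B $ \<rho> i $ j = (if i = j then 1 else 0)" for i j
  proof -
    have "(\<Sum>k\<in>UNIV. A $ i $ k * B $ k $ j) = (\<Sum>k\<in>{\<rho> i}. A $ i $ k * B $ k $ j)"
      using zero by (intro sum.mono_neutral_right) auto
    then show ?thesis
      using AB'[of i j] by simp
  qed
  have "inj \<rho>"
  proof (rule injI, rule ccontr)
    fix i i' assume "\<rho> i = \<rho> i'" "i \<noteq> i'"
    then have "B $ \<rho> i' $ i' = 0"
      using prod[of i i'] \<rho>[of i] by simp
    then show False
      using prod[of i' i'] by simp
  qed
  then have bij: "bij \<rho>"
    by (simp add: finite_UNIV_inj_surj bij_def)
  have unit: "A $ i $ \<rho> i = 1 \<or> A $ i $ \<rho> i = - 1" for i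
    using prod[of i i] by (auto simp: zmult_eq_1_iff)
  \<comment> \<open>\<open>hyperoctahedral\<close> is described by columns and \<rho> by rows, hence
    the inverse.\<close>
  define \<pi> where "\<pi> = inv_into UNIV \<rho>"
  have inv: "i = \<pi> j \<longleftrightarrow> j = \<rho> i" for i j
    unfolding \<pi>_def using bij by (metis bij_inv_eq_iff)
  have entry: "A $ i $ j = (if i = \<pi> j then A $ \<pi> j $ j else 0)" for i j
    using inv[of i j] zero[of j i] by (cases "i = \<pi> j") simp_all
  have "column j A \<in> {axis (\<pi> j) 1, - axis (\<pi> j) 1}" for j
  proof (cases "A $ \<pi> j $ j = 1")
    case True
    have "column j A $ i = (axis (\<pi> j) 1) $ i" for i
      using entry[of i j] True by (simp add: column_def axis_def)
    then have "column j A = axis (\<pi> j) 1"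
      by (simp add: vec_eq_iff)
    then show ?thesis by simp
  next
    case False
    then have "A $ \<pi> j $ j = - 1"
      using unit[of "\<pi> j"] inv[of "\<pi> j" j] by simp
    have "column j A $ i = (- axis (\<pi> j) 1) $ i" for i
      using entry[of i j] \<open>A $ \<pi> j $ j = - 1\<close> by (simp add: column_def axis_def)
    then have "column j A = - axis (\<pi> j) 1"
      by (simp add: vec_eq_iff)
    then show ?thesis by simp
  qed
  moreover have "\<pi> permutes UNIV"
    unfolding \<pi>_def using bij by (intro bij_imp_permutes bij_imp_bij_inv) auto
  ultimately show ?thesis
    unfolding hyperoctahedral_def by blast
qed

section \<open>Pairs differing on a half space and their images\<close>

context rect_subst
begin

text \<open>Otherwise each letter would determine its successor in direction \<open>i\<close>, by
  the same map throughout \<open>X\<close>. All points would then be periodic in that direction with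
  one common period, against faithfulness.\<close>

lemma branching:
  assumes faithful: "faithful_shift X"
  shows "\<exists>u\<in>X. \<exists>v\<in>X. u (- axis i 1) = v (- axis i 1) \<and> u 0 \<noteq> v 0"
proof (rule ccontr)
  assume "\<not> ?thesis"
  then have H: "u 0 = v 0" if "u \<in> X" "v \<in> X" "u (- axis i 1) = v (- axis i 1)" for u v
    using that by blast
  have step: "x (p + axis i 1) = x (q + axis i 1)" if "x \<in> X" "x p = x q" for x p q
    using H[of "shift (- p - axis i 1) x" "shift (- q - axis i 1) x"] that
    by (simp add: shift_in algebra_simps)
  have axis0: "axis i (0 :: int) = 0"
    by (simp add: vec_eq_iff axis_def)
  have steps: "x (p + axis i (int n)) = x (q + axis i (int n))" if "x \<in> X" "x p = x q" for x p q n
  proof (induction n)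
    case 0
    then show ?case using that by (simp add: axis0)
  next
    case (Suc n)
    have eq: "p + axis i (int (Suc n)) = p + axis i (int n) + axis i 1" for p :: "int ^ 'd"
      by (simp add: vec_eq_iff axis_def)
    show ?case
      unfolding eq by (rule step[OF that(1) Suc])
  qed
  define N where "N = card (UNIV :: 'a set)"
  have "shift (- axis i (int (fact N))) x = x" if x: "x \<in> X" for x
  proof
    fix m
    \<comment> \<open>The \<open>N + 1\<close> positions end at \<open>m\<close>, so a repetition
      among them propagates forward to \<open>m\<close>. Its period is at most \<open>N\<close> and
      hence divides \<open>fact N\<close>.\<close>
    define f where "f = (\<lambda>j. x (m + axis i (int j - int N)))"
    have "\<not> inj_on f {..N}"
    proof
      assume "inj_on f {..N}"
      then have "card {..N} \<le> card (UNIV :: 'a set)"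
        by (rule card_inj_on_le) auto
      then show False
        by (simp add: N_def)
    qed
    then obtain j k where jk: "j \<le> N" "k \<le> N" "j < k" "f j = f k"
      unfolding inj_on_def by (metis atMost_iff linorder_neqE_nat)
    define t where "t = k - j"
    have per: "x (m + axis i (int (l * t))) = x m" for l
    proof (induction l)
      case 0
      then show ?case by (simp add: axis0)
    next
      case (Suc l)
      have pos: "m + axis i (int j - int N) + axis i (int (N - j + l * t)) = m + axis i (int (l * t))"
           "m + axis i (int k - int N) + axis i (int (N - j + l * t)) = m + axis i (int (Suc l * t))"
        using jk by (simp_all add: vec_eq_iff axis_def t_def of_nat_diff)
      have "x (m + axis i (int j - int N)) = x (m + axis i (int k - int N))"
        using jk(4) by (simp only: f_def)
      from steps[OF x this, of "N - j + l * t"] show ?case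
        unfolding pos using Suc by simp
    qed
    have "t dvd fact N"
      using jk by (intro dvd_fact) (auto simp: t_def)
    then obtain l where "fact N = l * t"
      by (metis dvd_def mult.commute)
    then have "x (m + axis i (int (fact N))) = x m"
      using per[of l] by (simp only:)
    then show "shift (- axis i (int (fact N))) x m = x m"
      by simp
  qed
  then have "- axis i (int (fact N)) = (0 :: int ^ 'd)"
    using faithful unfolding faithful_shift_def by blast
  then have "int (fact N) = 0"
    by (metis axis_eq_0_iff neg_equal_0_iff_equal)
  then show False
    by simp
qed

text \<open>The inflated pair coincides on the block below the face \<open>m $ i = 0\<close> and, by
  bijectivity, differs everywhere on the block above it. Growing blocks and a cluster point remove
  all other faces.\<close>

lemma asymptotic_pair:
  assumes faithful: "faithful_shift X"
  shows "\<exists>x\<in>X. \<exists>y\<in>X. \<forall>p. x p = y p \<longleftrightarrow> p $ i < 0"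
proof -
  obtain u v where uv: "u \<in> X" "v \<in> X" "u (- axis i 1) = v (- axis i 1)" "u 0 \<noteq> v 0"
    using branching[OF faithful, of i] by blast
  \<comment> \<open>The entry 0 in direction \<open>i\<close> keeps the face in place; half a side
    in the other directions centres the cube of radius \<open>n\<close>.\<close>
  define c where "c = (\<lambda>n. \<chi> j. if j = i then 0 else s $ j ^ Suc n div 2)"
  define x where "x = (\<lambda>n. shift (- c n) (T (Suc n) u))"
  define y where "y = (\<lambda>n. shift (- c n) (T (Suc n) v))"
  have X: "x n \<in> X" "y n \<in> X" for n
    unfolding x_def y_def by (intro shift_in inflate_in uv)+
  have xy: "x n m = y n m \<longleftrightarrow> m $ i < 0" if m: "m \<in> cube (int n)" for n m
  proof -
    have m': "- int n \<le> m $ j" "m $ j \<le> int n" for j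
      using m by (auto simp: cube_def abs_le_iff minus_le_iff)
    have "int (Suc n) \<le> int (2 ^ n)"
      unfolding of_nat_le_iff by (rule Suc_leI, rule less_exp)
    then have "int n + 1 \<le> 2 ^ n"
      by (simp only: of_nat_power of_nat_numeral of_nat_Suc add.commute)
    \<comment> \<open>The extra level doubles the bound, so half a side, rounded down, still exceeds
      \<open>n\<close>.\<close>
    then have big: "2 * int n + 2 \<le> s $ j ^ Suc n" for j
      using s_pow_ge[where i = j and n = "Suc n"] by simp
    have "vdiv (m + c n) (L (Suc n)) = (if m $ i < 0 then - axis i 1 else 0)"
      unfolding vdiv_eq_iff
    proof
      fix j
      show "(if m $ i < 0 then - axis i 1 else 0 :: int ^ 'd) $ j * s $ j ^ Suc n \<le> (m + c n) $ j \<and>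
        (m + c n) $ j < ((if m $ i < 0 then - axis i 1 else 0 :: int ^ 'd) $ j + 1) * s $ j ^ Suc n"
      proof (cases "j = i")
        case True
        then show ?thesis
          using m'[of i] big[of i] by (simp add: c_def axis_def)
      next
        case False
        define l where "l = s $ j ^ Suc n"
        have "0 \<le> m $ j + l div 2 \<and> m $ j + l div 2 < l"
          using m'[of j] big[of j] unfolding l_def[symmetric] by linarith
        then show ?thesis
          using False by (simp add: c_def axis_def l_def)
      qed
    qed
    then show ?thesis
      using uv by (simp add: x_def y_def inflate_def subst_iter_inj del: subst_iter.simps)
  qed
  obtain x' y' where x'y': "x' \<in> X" "y' \<in> X"
    "\<And>F N. finite F \<Longrightarrow> \<exists>n\<ge>N. \<forall>m\<in>F. x n m = x' m \<and> y n m = y' m"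
    using cluster_pair[of x y, OF X] by blast
  have "x' p = y' p \<longleftrightarrow> p $ i < 0" for p
  proof -
    obtain r where r: "{p} \<subseteq> cube r"
      by (rule finite_subset_cube[of "{p}"]) simp_all
    obtain n where n: "n \<ge> nat r" "\<forall>m\<in>{p}. x n m = x' m \<and> y n m = y' m"
      using x'y'(3)[of "{p}" "nat r"] by blast
    have "cube r \<subseteq> cube (int n)"
      using n(1) by (intro cube_mono) linarith
    then show ?thesis
      using xy[of p n] n(2) r by auto
  qed
  with x'y'(1,2) show ?thesis
    by blast
qed

text \<open>
  The set where \<open>x\<close> and \<open>y\<close> differ is a union of blocks of any level \<open>n\<close>. If \<open>v\<close> had two nonzero
  entries, some block would reach far to both sides of the hyperplane \<open>v \<bullet> m = 0\<close>.
\<close>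

lemma half_space_normal:
  fixes v :: "int ^ 'd"
  defines "\<phi> \<equiv> \<lambda>m. \<Sum>l\<in>UNIV. v $ l * m $ l"
  assumes X: "x \<in> X" "y \<in> X" and r: "r \<ge> 0" "r' \<ge> 0"
    and agree: "\<And>m. \<phi> m < - r \<Longrightarrow> x m = y m"
    and differ: "\<And>m. \<phi> m \<ge> 0 \<Longrightarrow> \<exists>c\<in>cube r'. x (m + c) \<noteq> y (m + c)"
    and j: "v $ j \<noteq> 0" and k: "v $ k \<noteq> 0"
  shows "j = k"
proof (rule ccontr)
  assume "j \<noteq> k"
  have \<phi>_add: "\<phi> (a + b) = \<phi> a + \<phi> b" for a b
    by (simp add: \<phi>_def algebra_simps sum.distrib)
  have \<phi>_diff: "\<phi> (a - b) = \<phi> a - \<phi> b" for a b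
    by (simp add: \<phi>_def algebra_simps sum_subtractf)
  \<comment> \<open>Going against \<open>v\<close> far enough leaves room for any cube in the region
    of agreement, so \<open>x\<close> and \<open>y\<close> share their addresses.\<close>
  have far: "\<exists>c. \<forall>m\<in>cube R. x (c + m) = y (c + m)" for R
  proof -
    define S where "S = (\<Sum>l\<in>UNIV. \<bar>v $ l\<bar>)"
    define K where "K = r + 1 + \<bar>R\<bar> * S"
    define c where "c = (\<chi> l. - K * v $ l)"
    have "S \<ge> 0"
      by (auto simp: S_def intro: sum_nonneg)
    then have "K \<ge> 1"
      using r by (simp add: K_def)
    have "(1 :: int) \<le> v $ j * v $ j"
      using j by (metis mult_le_0_iff not_le int_one_le_iff_zero_less zero_less_mult_iff linorder_neqE_linordered_idom)
    also have "\<dots> \<le> (\<Sum>l\<in>UNIV. v $ l * v $ l)"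
      by (rule member_le_sum) auto
    finally have "K * 1 \<le> K * (\<Sum>l\<in>UNIV. v $ l * v $ l)"
      using \<open>K \<ge> 1\<close> by (intro mult_left_mono) auto
    moreover have "\<phi> c = - K * (\<Sum>l\<in>UNIV. v $ l * v $ l)"
      by (simp add: \<phi>_def c_def sum_distrib_left algebra_simps sum_negf)
    ultimately have \<phi>c: "\<phi> c \<le> - K"
      by simp
    have "x (c + m) = y (c + m)" if "m \<in> cube R" for m
    proof (rule agree)
      have "v $ l * m $ l \<le> \<bar>v $ l\<bar> * \<bar>R\<bar>" for l
      proof -
        have "\<bar>m $ l\<bar> \<le> \<bar>R\<bar>"
          using that by (auto simp: cube_def intro: order_trans)
        then have "\<bar>v $ l\<bar> * \<bar>m $ l\<bar> \<le> \<bar>v $ l\<bar> * \<bar>R\<bar>"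
          by (intro mult_left_mono) auto
        moreover have "v $ l * m $ l \<le> \<bar>v $ l\<bar> * \<bar>m $ l\<bar>"
          by (metis abs_ge_self abs_mult)
        ultimately show ?thesis
          by simp
      qed
      then have "\<phi> m \<le> (\<Sum>l\<in>UNIV. \<bar>v $ l\<bar> * \<bar>R\<bar>)"
        unfolding \<phi>_def by (intro sum_mono) auto
      also have "\<dots> = \<bar>R\<bar> * S"
        by (simp add: S_def sum_distrib_left mult.commute)
      finally show "\<phi> (c + m) < - r"
        using \<phi>c by (simp add: \<phi>_add K_def)
    qed
    then show ?thesis
      by blast
  qed
  \<comment> \<open>\<open>r'\<close> positions are cut off at both ends of each side, so
    \<open>cube r'\<close> around a corner of the reduced block stays in the block. A reduced side
    spans \<open>s $ l ^ n - M\<close>.\<close>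
  define M where "M = 1 + 2 * r'"
  \<comment> \<open>Direction \<open>k\<close> contributes at least \<open>s $ k ^ n - M\<close>,
    which must make up for the \<open>\<bar>v $ j\<bar> * M\<close> cut off in direction
    \<open>j\<close> and for the gap \<open>r\<close>.\<close>
  define Q where "Q = M + r + \<bar>v $ j\<bar> * M"
  define n where "n = nat Q"
  have "M \<ge> 1"
    using r by (simp add: M_def)
  have "int n < int (2 ^ n)"
    unfolding of_nat_less_iff by (rule less_exp)
  then have "int n < 2 ^ n"
    by (simp only: of_nat_power of_nat_numeral)
  moreover have "Q \<le> int n"
    by (simp add: n_def)
  ultimately have "Q < 2 ^ n"
    by linarith
  then have big: "Q < s $ l ^ n" for l
    using s_pow_ge[where i = l and n = n] by simp
  have "Q \<ge> M"
    using r \<open>M \<ge> 1\<close> by (simp add: Q_def)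
  have bigM: "M < s $ l ^ n" for l
    using big[of l] \<open>Q \<ge> M\<close> by simp
  obtain g where g: "g \<in> addr n x" "g \<in> addr n y"
    using addresses_nonempty[OF X(1)] addresses_eq[OF X far] by blast
  \<comment> \<open>Corners of the reduced block at which \<phi> is smallest and largest.\<close>
  define lo where "lo = (\<chi> l. if v $ l \<ge> 0 then r' else s $ l ^ n - 1 - r')"
  define hi where "hi = (\<chi> l. if v $ l \<ge> 0 then s $ l ^ n - 1 - r' else r')"
  define d where "d = \<bar>v $ j\<bar> * s $ j ^ n"
  have "d > 0"
    using j s_pow_pos by (simp add: d_def)
  have "\<phi> hi - \<phi> lo = (\<Sum>l\<in>UNIV. \<bar>v $ l\<bar> * (s $ l ^ n - M))"
    unfolding \<phi>_def sum_subtractf[symmetric]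
    by (intro sum.cong) (auto simp: hi_def lo_def M_def algebra_simps)
  also have "\<dots> \<ge> (\<Sum>l\<in>{j, k}. \<bar>v $ l\<bar> * (s $ l ^ n - M))"
    using bigM by (intro sum_mono2) (auto intro!: mult_nonneg_nonneg simp: less_imp_le)
  also have "(\<Sum>l\<in>{j, k}. \<bar>v $ l\<bar> * (s $ l ^ n - M)) = \<bar>v $ j\<bar> * (s $ j ^ n - M) + \<bar>v $ k\<bar> * (s $ k ^ n - M)"
    using \<open>j \<noteq> k\<close> by simp
  finally have "\<phi> hi - \<phi> lo \<ge> \<bar>v $ j\<bar> * (s $ j ^ n - M) + \<bar>v $ k\<bar> * (s $ k ^ n - M)" .
  moreover have "\<bar>v $ k\<bar> * (s $ k ^ n - M) \<ge> 1 * (s $ k ^ n - M)"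
    using k bigM[of k] by (intro mult_right_mono) auto
  ultimately have wide: "\<phi> hi - \<phi> lo \<ge> d + r"
    using big[of k] by (simp add: d_def Q_def algebra_simps)
  \<comment> \<open>Moving the block one step along axis \<open>j\<close> changes \<phi> by
    \<open>d\<close> up to sign. The number of steps \<open>t\<close> brings the value at the upper
    corner to its residue modulo \<open>d\<close>.\<close>
  define t where "t = - (sgn (v $ j) * (\<phi> (hi - g) div d))"
  define q :: "int ^ 'd" where "q = axis j t"
  have "\<phi> (L n * q) = (\<Sum>l\<in>UNIV. if l = j then v $ j * (s $ j ^ n * t) else 0)"
    unfolding \<phi>_def by (intro sum.cong) (auto simp: q_def axis_def)
  also have "\<dots> = v $ j * (s $ j ^ n * t)"
    by simp
  also have "\<dots> = - (d * (\<phi> (hi - g) div d))"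
    by (simp add: t_def d_def abs_sgn algebra_simps)
  finally have \<phi>q: "\<phi> (L n * q) = - (d * (\<phi> (hi - g) div d))" .
  define m1 where "m1 = L n * q + (lo - g)"
  define m2 where "m2 = L n * q + (hi - g)"
  have "\<phi> m2 = \<phi> (hi - g) mod d"
    unfolding m2_def \<phi>_add \<phi>q minus_mult_div_eq_mod[symmetric] by simp
  then have m2: "0 \<le> \<phi> m2" "\<phi> m2 < d"
    using \<open>d > 0\<close> by simp_all
  \<comment> \<open>The value at \<open>m2\<close> is below \<open>d\<close>, and from
    \<open>m1\<close> to \<open>m2\<close> it grows by at least \<open>d + r\<close>.\<close>
  have "\<phi> m1 < - r"
    using m2 wide by (simp add: m1_def m2_def \<phi>_add \<phi>_diff)
  then have eq1: "x m1 = y m1"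
    by (rule agree)
  obtain c where c: "c \<in> cube r'" "x (m2 + c) \<noteq> y (m2 + c)"
    using differ[OF m2(1)] by blast
  have block: "vdiv (b + L n * q) (L n) = q" if "\<And>l. 0 \<le> b $ l \<and> b $ l < s $ l ^ n" for b
    using that by (simp add: vdiv_add) (simp add: vdiv_eq_iff)
  have "vdiv (lo + L n * q) (L n) = q"
  proof (rule block)
    fix l
    show "0 \<le> lo $ l \<and> lo $ l < s $ l ^ n"
      using r bigM[of l] by (auto simp: lo_def M_def)
  qed
  then have v1: "vdiv (m1 + g) (L n) = q"
    by (simp add: m1_def algebra_simps)
  have "vdiv ((hi + c) + L n * q) (L n) = q"
  proof (rule block)
    fix l
    have "- r' \<le> c $ l" "c $ l \<le> r'"
      using c(1) by (auto simp: cube_def abs_le_iff minus_le_iff)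
    then show "0 \<le> (hi + c) $ l \<and> (hi + c) $ l < s $ l ^ n"
      using bigM[of l] by (auto simp: hi_def M_def)
  qed
  then have v2: "vdiv (m2 + c + g) (L n) = q"
    by (simp add: m2_def algebra_simps)
  obtain a where a: "\<And>m. vdiv (m + g) (L n) = q \<Longrightarrow> x m = \<Theta> n a (m + g)"
    using g(1) unfolding addresses_def aligned_def by blast
  obtain b where b: "\<And>m. vdiv (m + g) (L n) = q \<Longrightarrow> y m = \<Theta> n b (m + g)"
    using g(2) unfolding addresses_def aligned_def by blast
  \<comment> \<open>Agreement at the single point \<open>m1\<close> makes the blocks equal, against
    the difference near \<open>m2\<close>.\<close>
  have "a = b"
    using eq1 a[OF v1] b[OF v1] subst_iter_inj by metis
  then show False
    using c(2) a[OF v2] b[OF v2] by simp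
qed

text \<open>The differences of the image of an asymptotic pair follow the half space whose normal is
  row \<open>i\<close> of \<open>B\<close>: \<open>local_rule\<close> gives agreement where the form
  is below \<open>- r\<close>, \<open>inverse_local_rule\<close> a difference within
  \<open>r'\<close> of every point where it is nonnegative.\<close>

lemma inverse_matrix_rows:
  assumes faithful: "faithful_shift X" and f: "f \<in> ext_symmetries X" and A: "intertwines X f A"
    and AB: "A ** B = mat 1"
    and jk: "B $ i $ j \<noteq> 0" "B $ i $ k \<noteq> 0"
  shows "j = k"
proof -
  have fX: "f z \<in> X" if "z \<in> X" for z
    using f that by (auto simp: ext_symmetries_def dest: Bij_imp_funcset)
  have cont: "continuous_map (subtopology full_shift_topology X) (subtopology full_shift_topology X) f"
    and inj: "inj_on f X"
    using f by (auto simp: ext_symmetries_def Bij_def bij_betw_def)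
  obtain r where r: "r \<ge> 0" "\<And>x y. x \<in> X \<Longrightarrow> y \<in> X \<Longrightarrow> (\<forall>m\<in>cube r. x m = y m) \<Longrightarrow> f x 0 = f y 0"
    by (rule local_rule[OF cont]) blast
  obtain r' where r': "r' \<ge> 0" "\<And>x y. x \<in> X \<Longrightarrow> y \<in> X \<Longrightarrow> (\<forall>m\<in>cube r'. f x m = f y m) \<Longrightarrow> x 0 = y 0"
    by (rule inverse_local_rule[OF cont inj]) blast
  obtain x y where xy: "x \<in> X" "y \<in> X" "\<And>p. x p = y p \<longleftrightarrow> p $ i < 0"
    using asymptotic_pair[OF faithful, of i] by blast
  \<comment> \<open>Reading the image at \<open>m\<close> means reading the source around
    \<open>B *v m\<close>.\<close>
  have f_shift: "f (shift (- (B *v m)) z) c = f z (m + c)" if "z \<in> X" for z m c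
  proof -
    have "A *v (- (B *v m)) = - (A *v (B *v m))"
      by (simp add: vec_eq_iff matrix_vector_mult_def sum_negf)
    also have "A *v (B *v m) = m"
      by (simp add: matrix_vector_mul_assoc AB)
    finally have "A *v (- (B *v m)) = - m" .
    then show ?thesis
      using A that unfolding intertwines_def by (simp add: add.commute)
  qed
  have row: "(B *v m) $ i = (\<Sum>l\<in>UNIV. B $ i $ l * m $ l)" for m
    by (simp add: matrix_vector_mult_def)
  show ?thesis
  proof (rule half_space_normal[where x = "f x" and y = "f y" and v = "B $ i" and r = r and r' = r'])
    show "f x \<in> X" "f y \<in> X"
      using fX xy by simp_all
    show "r \<ge> 0" "r' \<ge> 0" by fact+
  next
    fix m
    assume "(\<Sum>l\<in>UNIV. B $ i $ l * m $ l) < - r"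
    then have less: "(B *v m) $ i < - r"
      by (simp add: row)
    have "f (shift (- (B *v m)) x) 0 = f (shift (- (B *v m)) y) 0"
    proof (rule r(2); (intro shift_in xy ballI)?)
      fix c :: "int ^ 'd" assume "c \<in> cube r"
      then have "c $ i \<le> r"
        by (auto simp: cube_def abs_le_iff)
      then show "shift (- (B *v m)) x c = shift (- (B *v m)) y c"
        using less by (simp add: xy(3))
    qed
    then show "f x m = f y m"
      using xy by (simp add: f_shift)
  next
    fix m
    assume "(\<Sum>l\<in>UNIV. B $ i $ l * m $ l) \<ge> 0"
    then have "shift (- (B *v m)) x 0 \<noteq> shift (- (B *v m)) y 0"
      by (simp add: row xy(3))
    then have "\<exists>c\<in>cube r'. f (shift (- (B *v m)) x) c \<noteq> f (shift (- (B *v m)) y) c"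
      using r'(2)[of "shift (- (B *v m)) x" "shift (- (B *v m)) y"] shift_in xy by blast
    then show "\<exists>c\<in>cube r'. f x (m + c) \<noteq> f y (m + c)"
      using xy by (simp add: f_shift)
  qed (use jk in simp_all)
qed

end

section \<open>Automorphisms and the index of the shifts\<close>

context rect_subst
begin

text \<open>
  On inflated points an automorphism acts as a letter map combined with a shift, because
  the centre of a large block sees no other block through the window of the local rule.
\<close>

lemma automorphism_on_inflated:
  assumes h: "h \<in> ext_symmetries X" "intertwines X h (mat 1)" and x0: "x0 \<in> X"
  shows "\<forall>\<^sub>F n in sequentially. \<exists>\<tau> g. \<forall>x\<in>X. \<forall>m. h (T n x) m = T n (\<tau> \<circ> x) (m + g)"
proof -
  have hX: "h z \<in> X" if "z \<in> X" for z
    using h(1) that by (auto simp: ext_symmetries_def dest: Bij_imp_funcset)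
  have cont: "continuous_map (subtopology full_shift_topology X) (subtopology full_shift_topology X) h"
    using h(1) by (auto simp: ext_symmetries_def)
  obtain r where r: "r \<ge> 0" "\<And>x y. x \<in> X \<Longrightarrow> y \<in> X \<Longrightarrow> (\<forall>m\<in>cube r. x m = y m) \<Longrightarrow> h x 0 = h y 0"
    by (rule local_rule[OF cont]) blast
  have h_shift: "h (shift p z) = shift p (h z)" if "z \<in> X" for z p
    using h(2) that by (simp add: intertwines_def)
  have h_local: "h x c = h y d"
    if "x \<in> X" "y \<in> X" "\<And>m. m \<in> cube r \<Longrightarrow> x (c + m) = y (d + m)" for x y c d
  proof -
    have "h (shift (- c) x) 0 = h (shift (- d) y) 0"
      using that by (intro r(2) shift_in) (simp_all add: add.commute)
    then show ?thesis
      using that by (simp add: h_shift)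
  qed
  have "\<exists>\<tau> g. \<forall>x\<in>X. \<forall>m. h (T n x) m = T n (\<tau> \<circ> x) (m + g)" if n: "n \<ge> nat (2 * r)" for n
  proof -
    have "int n < int (2 ^ n)"
      unfolding of_nat_less_iff by (rule less_exp)
    then have "int n < 2 ^ n"
      by (simp only: of_nat_power of_nat_numeral)
    then have big: "2 * r < s $ l ^ n" for l
      using n s_pow_ge[where i = l and n = n] by linarith
    obtain g where g: "g \<in> addr n (h (T n x0))"
      using addresses_nonempty[OF hX[OF inflate_in[OF x0]]] by blast
    \<comment> \<open>The address of one image serves for all \<open>x\<close>: by repetitivity the
      letters of \<open>x\<close> that affect the block also occur in \<open>x0\<close>, and
      inflation turns the translation \<open>p\<close> into \<open>L n * p\<close>.\<close>
    have aligned: "aligned s \<theta> n g (h (T n x)) q" if x: "x \<in> X" for x q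
    proof -
      define F where "F = (\<lambda>(m, c). vdiv (m + c) (L n)) ` ({m. vdiv (m + g) (L n) = q} \<times> cube r)"
      have "finite F"
        unfolding F_def by (intro finite_imageI finite_cartesian_product finite_block finite_cube)
      then obtain p where p: "\<forall>m\<in>F. x0 (m + p) = x m"
        using repetitive[OF x] x0 by blast
      have "aligned s \<theta> n g (h (T n x0)) (q + p)"
        using g by (simp add: addresses_def)
      then obtain a where a: "\<And>m. vdiv (m + g) (L n) = q + p \<Longrightarrow> h (T n x0) m = \<Theta> n a (m + g)"
        unfolding aligned_def by blast
      have "h (T n x) m = \<Theta> n a (m + g)" if m: "vdiv (m + g) (L n) = q" for m
      proof -
        have "h (T n x) m = h (T n x0) (m + L n * p)"
        proof (rule h_local)
          fix c :: "int ^ 'd" assume "c \<in> cube r"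
          then have "vdiv (m + c) (L n) \<in> F"
            unfolding F_def using m by force
          then have "x0 (vdiv (m + c) (L n) + p) = x (vdiv (m + c) (L n))"
            using p by blast
          moreover have "m + L n * p + c = m + c + L n * p"
            by simp
          ultimately show "T n x (m + c) = T n x0 (m + L n * p + c)"
            by (simp only: inflate_def vdiv_add subst_iter_periodic)
        qed (intro inflate_in x x0)+
        also have "\<dots> = \<Theta> n a (m + L n * p + g)"
        proof (rule a)
          have "m + L n * p + g = m + g + L n * p"
            by simp
          then show "vdiv (m + L n * p + g) (L n) = q + p"
            by (simp only: vdiv_add m)
        qed
        also have "m + L n * p + g = m + g + L n * p"
          by simp
        finally show ?thesis
          by (simp only: subst_iter_periodic)
      qed
      then show ?thesis
        unfolding aligned_def by blast
    qed
    define c where "c = (\<chi> l. s $ l ^ n div 2)"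
    have centre: "vdiv (c + m) (L n) = 0" if "m \<in> cube r" for m
      unfolding vdiv_eq_iff
    proof
      fix l
      define d where "d = s $ l ^ n"
      have "- r \<le> m $ l" "m $ l \<le> r"
        using that by (auto simp: cube_def abs_le_iff minus_le_iff)
      then have "0 \<le> d div 2 + m $ l" "d div 2 + m $ l < d"
        using big[of l] unfolding d_def[symmetric] by linarith+
      then show "0 $ l * s $ l ^ n \<le> (c + m) $ l \<and> (c + m) $ l < (0 $ l + 1) * s $ l ^ n"
        by (simp add: c_def d_def)
    qed
    \<comment> \<open>Index of the block of the image that contains the centre \<open>c\<close>. The
      letter of the image at \<open>c\<close> depends on \<open>x 0\<close> alone and, by
      \<open>subst_iter_inj\<close>, so does the whole block.\<close>
    define e where "e = vdiv (c + g) (L n)"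
    define P where "P = (\<lambda>x a. \<forall>m. vdiv (m + g) (L n) = e \<longrightarrow> h (T n x) m = \<Theta> n a (m + g))"
    have P_ex: "\<exists>a. P x a" if "x \<in> X" for x
      using aligned[OF that, of e] by (simp add: P_def aligned_def)
    have P_unique: "a = b" if "x \<in> X" "y \<in> X" "x 0 = y 0" "P x a" "P y b" for x y a b
    proof -
      have "h (T n x) c = h (T n y) c"
      proof (rule h_local)
        fix m :: "int ^ 'd" assume "m \<in> cube r"
        then show "T n x (c + m) = T n y (c + m)"
          using that(3) centre by (simp add: inflate_def)
      qed (intro inflate_in that)+
      then have "\<Theta> n a (c + g) = \<Theta> n b (c + g)"
        using that(4,5) unfolding P_def e_def by simp
      then show ?thesis
        by (simp only: subst_iter_inj)
    qed
    \<comment> \<open>\<open>P_unique\<close> makes the choice independent of the witness.\<close>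
    define \<tau> where "\<tau> = (\<lambda>b. SOME a. \<exists>x\<in>X. x 0 = b \<and> P x a)"
    have P_\<tau>: "P x (\<tau> (x 0))" if x: "x \<in> X" for x
    proof -
      obtain a where a: "P x a"
        using P_ex[OF x] by blast
      then have "\<exists>y\<in>X. y 0 = x 0 \<and> P y (\<tau> (x 0))"
        unfolding \<tau>_def using x by (intro someI_ex[of "\<lambda>a. \<exists>y\<in>X. y 0 = x 0 \<and> P y a"]) blast
      then obtain y where y: "y \<in> X" "y 0 = x 0" "P y (\<tau> (x 0))"
        by blast
      then show ?thesis
        using P_unique[OF x y(1) y(2)[symmetric] a y(3)] a by simp
    qed
    have "h (T n x) m = T n (\<tau> \<circ> x) (m + (g + L n * (- e)))" if x: "x \<in> X" for x m
    proof -
      \<comment> \<open>Shifting \<open>x\<close> by \<open>- q\<close> moves the block of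
        \<open>m\<close> to block \<open>e\<close>, where the letter is already identified.\<close>
      define q where "q = vdiv (m + g) (L n) - e"
      define m' where "m' = m + L n * (- q)"
      have m'g: "m' + g = m + g + L n * (- q)"
        by (simp add: m'_def)
      have v: "vdiv (m' + g) (L n) = e"
        unfolding m'g vdiv_add by (simp add: q_def)
      have "h (T n (shift (- q) x)) m' = \<Theta> n (\<tau> (x q)) (m' + g)"
        using P_\<tau>[OF shift_in[OF x], of "- q"] v by (simp add: P_def)
      also have "\<dots> = \<Theta> n (\<tau> (x q)) (m + g)"
        by (simp only: m'g subst_iter_periodic)
      also have "h (T n (shift (- q) x)) m' = h (T n x) m"
        unfolding inflate_shift h_shift[OF inflate_in[OF x]] by (simp add: m'_def)
      finally have "h (T n x) m = \<Theta> n (\<tau> (x q)) (m + g)" .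
      moreover have "m + (g + L n * (- e)) = m + g + L n * (- e)"
        by simp
      moreover have "vdiv (m + g) (L n) + - e = q"
        by (simp add: q_def)
      ultimately show ?thesis
        by (simp only: inflate_def vdiv_add subst_iter_periodic comp_apply)
    qed
    then show ?thesis
      by blast
  qed
  then show ?thesis
    by (auto simp: eventually_sequentially)
qed

text \<open>On the single point \<open>T n x0\<close> the two formulas differ by a shift. Since
  every pattern of \<open>X\<close> recurs in that point, the local rules extend the relation to all
  of \<open>X\<close>.\<close>

lemma automorphisms_equal_mod_shift:
  assumes h: "h \<in> ext_symmetries X" "intertwines X h (mat 1)"
    and h': "h' \<in> ext_symmetries X" "intertwines X h' (mat 1)"
    and x0: "x0 \<in> X"
    and g: "\<And>x m. x \<in> X \<Longrightarrow> h (T n x) m = T n (\<tau> \<circ> x) (m + g)"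
    and g': "\<And>x m. x \<in> X \<Longrightarrow> h' (T n x) m = T n (\<tau> \<circ> x) (m + g')"
  shows "\<exists>p. \<forall>x\<in>X. h x = shift p (h' x)"
proof -
  have cont: "continuous_map (subtopology full_shift_topology X) (subtopology full_shift_topology X) h"
    and cont': "continuous_map (subtopology full_shift_topology X) (subtopology full_shift_topology X) h'"
    using h(1) h'(1) by (auto simp: ext_symmetries_def)
  obtain r where r: "\<And>x y. x \<in> X \<Longrightarrow> y \<in> X \<Longrightarrow> (\<forall>m\<in>cube r. x m = y m) \<Longrightarrow> h x 0 = h y 0"
    by (rule local_rule[OF cont]) blast
  obtain r' where r': "\<And>x y. x \<in> X \<Longrightarrow> y \<in> X \<Longrightarrow> (\<forall>m\<in>cube r'. x m = y m) \<Longrightarrow> h' x 0 = h' y 0"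
    by (rule local_rule[OF cont']) blast
  define y where "y = T n x0"
  define p where "p = g' - g"
  have y: "y \<in> X"
    unfolding y_def by (rule inflate_in[OF x0])
  have hy: "h y m = h' y (m - p)" for m
    unfolding y_def g[OF x0] g'[OF x0] by (simp add: p_def algebra_simps)
  have "h z m = h' z (m - p)" if z: "z \<in> X" for z m
  proof -
    \<comment> \<open>One recurrence must serve both windows, that of \<open>h\<close> at
      \<open>m\<close> and that of \<open>h'\<close> at \<open>m - p\<close>.\<close>
    have "finite ((\<lambda>c. m + c) ` cube r \<union> (\<lambda>c. m - p + c) ` cube r')"
      by (intro finite_UnI finite_imageI finite_cube)
    then obtain t where t: "\<forall>k\<in>(\<lambda>c. m + c) ` cube r \<union> (\<lambda>c. m - p + c) ` cube r'. y (k + t) = z k"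
      using repetitive[OF z] y by blast
    have "h (shift (- m) z) 0 = h (shift (- (m + t)) y) 0"
    proof (intro r shift_in z y ballI)
      fix c :: "int ^ 'd" assume "c \<in> cube r"
      then have "y (m + c + t) = z (m + c)"
        using t[THEN bspec, of "m + c"] by simp
      moreover have "c - - m = m + c" "c - - (m + t) = m + c + t"
        by simp_all
      ultimately show "shift (- m) z c = shift (- (m + t)) y c"
        by (simp only: shift_apply)
    qed
    then have "h z m = h y (m + t)"
      using h(2) z y by (simp add: intertwines_def algebra_simps)
    have "h' (shift (- (m - p)) z) 0 = h' (shift (- (m - p + t)) y) 0"
    proof (intro r' shift_in z y ballI)
      fix c :: "int ^ 'd" assume "c \<in> cube r'"
      then have "y (m - p + c + t) = z (m - p + c)"
        using t[THEN bspec, of "m - p + c"] by simp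
      moreover have "c - - (m - p) = m - p + c" "c - - (m - p + t) = m - p + c + t"
        by simp_all
      ultimately show "shift (- (m - p)) z c = shift (- (m - p + t)) y c"
        by (simp only: shift_apply)
    qed
    then have "h' z (m - p) = h' y (m - p + t)"
      using h'(2) z y by (simp add: intertwines_def algebra_simps)
    moreover have "m + t - p = m - p + t"
      by simp
    ultimately show ?thesis
      using \<open>h z m = h y (m + t)\<close> hy[of "m + t"] by (simp only:)
  qed
  then show ?thesis
    by (intro exI[of _ p]) (simp add: fun_eq_iff)
qed

end

section \<open>Signed permutation matrices as a finite subgroup\<close>

lemma hyperoctahedral_permutation:
  fixes A :: "int ^ 'd ^ 'd"
  assumes "A \<in> hyperoctahedral"
  shows "\<exists>\<pi>. bij \<pi> \<and> (\<forall>i j. A $ i $ j \<noteq> 0 \<longleftrightarrow> i = \<pi> j) \<and> (\<forall>j. A $ \<pi> j $ j * A $ \<pi> j $ j = 1)"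
proof -
  obtain \<pi> where \<pi>: "\<pi> permutes UNIV" "\<And>j. column j A \<in> {axis (\<pi> j) 1, - axis (\<pi> j) 1}"
    using assms unfolding hyperoctahedral_def by blast
  have entry: "A $ i $ j = (if i = \<pi> j then 1 else 0) \<or> A $ i $ j = (if i = \<pi> j then - 1 else 0)" for i j
  proof -
    have "column j A $ i = axis (\<pi> j) 1 $ i \<or> column j A $ i = (- axis (\<pi> j) 1) $ i"
      using \<pi>(2)[of j] by (elim insertE emptyE) simp_all
    then show ?thesis
      by (simp add: column_def axis_def split: if_splits)
  qed
  have "A $ i $ j \<noteq> 0 \<longleftrightarrow> i = \<pi> j" for i j
    using entry[of i j] by (cases "i = \<pi> j") auto
  moreover have "A $ \<pi> j $ j * A $ \<pi> j $ j = 1" for j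
    using entry[of "\<pi> j" j] by auto
  ultimately show ?thesis
    using permutes_bij[OF \<pi>(1)] by blast
qed

text \<open>The columns have disjoint one-point supports with entries of square 1, so they are
  orthonormal.\<close>

lemma hyperoctahedral_transpose:
  fixes A :: "int ^ 'd ^ 'd"
  assumes A: "A \<in> hyperoctahedral"
  shows "transpose A ** A = mat 1" "A ** transpose A = mat 1" "transpose A \<in> hyperoctahedral"
proof -
  have *: "transpose A ** A = mat 1 \<and> transpose A \<in> hyperoctahedral" if A: "A \<in> hyperoctahedral" for A :: "int ^ 'd ^ 'd"
  proof -
    obtain \<pi> where \<pi>: "bij \<pi>" "\<And>i j. A $ i $ j \<noteq> 0 \<longleftrightarrow> i = \<pi> j" "\<And>j. A $ \<pi> j $ j * A $ \<pi> j $ j = 1"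
      using hyperoctahedral_permutation[OF A] by blast
    have zero: "A $ i $ j = 0" if "i \<noteq> \<pi> j" for i j
      using \<pi>(2) that by blast
    have "(\<Sum>k\<in>UNIV. A $ k $ i * A $ k $ j) = (if i = j then 1 else 0)" for i j
    proof -
      have "(\<Sum>k\<in>UNIV. A $ k $ i * A $ k $ j) = (\<Sum>k\<in>{\<pi> i}. A $ k $ i * A $ k $ j)"
        using zero by (intro sum.mono_neutral_right) auto
      also have "\<dots> = (if i = j then 1 else 0)"
        using \<pi>(3)[of i] zero[of "\<pi> i" j] bij_is_inj[OF \<pi>(1)] by (auto dest: injD)
      finally show ?thesis .
    qed
    then have id: "transpose A ** A = mat 1"
      by (simp add: vec_eq_iff matrix_matrix_mult_def mat_def transpose_def)
    moreover have "transpose A \<in> hyperoctahedral"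
    proof (rule monomial_rows_hyperoctahedral[OF id])
      fix i j k assume "transpose A $ i $ j \<noteq> 0" "transpose A $ i $ k \<noteq> 0"
      then show "j = k"
        using \<pi>(2) by (simp add: transpose_def)
    qed
    ultimately show ?thesis ..
  qed
  show "transpose A ** A = mat 1" "transpose A \<in> hyperoctahedral"
    using *[OF A] by blast+
  then show "A ** transpose A = mat 1"
    using *[of "transpose A"] by simp
qed

lemma hyperoctahedral_mult:
  fixes A A' :: "int ^ 'd ^ 'd"
  assumes A: "A \<in> hyperoctahedral" and A': "A' \<in> hyperoctahedral"
  shows "A ** A' \<in> hyperoctahedral"
proof (rule monomial_rows_hyperoctahedral)
  have "(A ** A') ** (transpose A' ** transpose A) = A ** (A' ** transpose A') ** transpose A"
    by (simp only: matrix_mul_assoc)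
  then show "(A ** A') ** (transpose A' ** transpose A) = mat 1"
    by (simp add: hyperoctahedral_transpose assms)
  fix i j k assume *: "(A ** A') $ i $ j \<noteq> 0" "(A ** A') $ i $ k \<noteq> 0"
  obtain \<pi> where \<pi>: "bij \<pi>" "\<And>i j. A $ i $ j \<noteq> 0 \<longleftrightarrow> i = \<pi> j"
    using hyperoctahedral_permutation[OF A] by blast
  obtain \<pi>' where \<pi>': "bij \<pi>'" "\<And>i j. A' $ i $ j \<noteq> 0 \<longleftrightarrow> i = \<pi>' j"
    using hyperoctahedral_permutation[OF A'] by blast
  have "i = \<pi> (\<pi>' j)" if nz: "(A ** A') $ i $ j \<noteq> 0" for j
  proof (rule ccontr)
    assume ne: "i \<noteq> \<pi> (\<pi>' j)"
    have "A $ i $ k * A' $ k $ j = 0" for k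
      using ne \<pi>(2)[of i k] \<pi>'(2)[of k j] by auto
    then have "(A ** A') $ i $ j = 0"
      unfolding matrix_matrix_mult_def by (simp only: vec_lambda_beta sum.neutral_const)
    then show False
      using nz by simp
  qed
  then have "\<pi> (\<pi>' j) = \<pi> (\<pi>' k)"
    using * by metis
  then show "j = k"
    using \<pi>(1) \<pi>'(1) by (auto dest!: bij_is_inj injD)
qed

lemma mat_1_hyperoctahedral: "mat 1 \<in> hyperoctahedral"
  by (rule monomial_rows_hyperoctahedral[OF matrix_mul_lid]) (auto simp: mat_def split: if_splits)

lemma finite_hyperoctahedral: "finite (hyperoctahedral :: (int ^ 'd ^ 'd) set)"
proof (rule finite_subset)
  show "finite {A :: int ^ 'd ^ 'd. \<forall>i. A $ i \<in> {w. \<forall>j. w $ j \<in> {-1, 0, 1}}}"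
    by (intro finite_vec_box) simp
  show "(hyperoctahedral :: (int ^ 'd ^ 'd) set) \<subseteq> {A. \<forall>i. A $ i \<in> {w. \<forall>j. w $ j \<in> {-1, 0, 1}}}"
  proof (intro subsetI CollectI allI)
    fix A :: "int ^ 'd ^ 'd" and i j
    assume A: "A \<in> hyperoctahedral"
    obtain \<pi> where "\<And>i j. A $ i $ j \<noteq> 0 \<longleftrightarrow> i = \<pi> j" "\<And>j. A $ \<pi> j $ j * A $ \<pi> j $ j = 1"
      using hyperoctahedral_permutation[OF A] by blast
    then have "A $ i $ j = 0 \<or> A $ i $ j * A $ i $ j = 1"
      by metis
    then show "A $ i $ j \<in> {-1, 0, 1}"
      by (auto simp: zmult_eq_1_iff)
  qed
qed

lemma GL_int_simps [simp]:
  "carrier GL_int = {A. invertible A}" "A \<otimes>\<^bsub>GL_int\<^esub> B = A ** B" "\<one>\<^bsub>GL_int\<^esub> = mat 1"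
  by (simp_all add: GL_int_def)

lemma group_GL_int: "group GL_int"
proof (rule groupI)
  fix A :: "int ^ 'd ^ 'd" assume "A \<in> carrier GL_int"
  then obtain B where "A ** B = mat 1" "B ** A = mat 1"
    by (auto simp: invertible_def)
  then show "\<exists>B\<in>carrier GL_int. B \<otimes>\<^bsub>GL_int\<^esub> A = \<one>\<^bsub>GL_int\<^esub>"
    by (auto simp: invertible_def)
next
  fix A C :: "int ^ 'd ^ 'd" assume "A \<in> carrier GL_int" "C \<in> carrier GL_int"
  then obtain B D where "A ** B = mat 1" "B ** A = mat 1" "C ** D = mat 1" "D ** C = mat 1"
    by (auto simp: invertible_def)
  moreover have "(A ** C) ** (D ** B) = A ** (C ** D) ** B" "(D ** B) ** (A ** C) = D ** (B ** A) ** C"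
    by (simp_all only: matrix_mul_assoc)
  ultimately show "A \<otimes>\<^bsub>GL_int\<^esub> C \<in> carrier GL_int"
    by (auto simp: invertible_def)
qed (auto simp: matrix_mul_assoc invertible_def intro: exI[of _ "mat 1"])

lemma subgroup_hyperoctahedral: "subgroup (hyperoctahedral :: (int ^ 'd ^ 'd) set) GL_int"
proof (rule group.subgroupI[OF group_GL_int])
  show sub: "hyperoctahedral \<subseteq> carrier (GL_int :: (int ^ 'd ^ 'd) monoid)"
    using hyperoctahedral_transpose by (auto simp: invertible_def)
  show "hyperoctahedral \<noteq> {}"
    using mat_1_hyperoctahedral by blast
  fix A B :: "int ^ 'd ^ 'd" assume A: "A \<in> hyperoctahedral"
  have "inv\<^bsub>GL_int\<^esub> A = transpose A"
    using A sub hyperoctahedral_transpose[OF A] by (intro group.inv_equality[OF group_GL_int]) auto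
  then show "inv\<^bsub>GL_int\<^esub> A \<in> hyperoctahedral"
    using hyperoctahedral_transpose[OF A] by simp
  assume "B \<in> hyperoctahedral"
  with A show "A \<otimes>\<^bsub>GL_int\<^esub> B \<in> hyperoctahedral"
    by (simp add: hyperoctahedral_mult)
qed

lemma group_int_lattice: "group int_lattice"
  by (rule groupI) (auto simp: int_lattice_def intro: exI[of _ "- x" for x])

text \<open>The separating map \<kappa> may depend on the finite set \<open>S\<close>, since it is
  enough to bound every finite set of cosets by \<open>card K\<close>. This freedom matters because
  the level found in \<open>automorphism_on_inflated\<close> depends on the symmetry.\<close>

lemma (in group) finite_rcosetsI:
  fixes K :: "'k set"
  assumes H: "subgroup H G" and K: "finite K"
    and separate: "\<And>S. finite S \<Longrightarrow> S \<subseteq> carrier G \<Longrightarrow>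
      \<exists>\<kappa> \<in> S \<rightarrow> K. \<forall>x\<in>S. \<forall>y\<in>S. \<kappa> x = \<kappa> y \<longrightarrow> x \<otimes> inv y \<in> H"
  shows "finite (rcosets H)"
proof -
  have "card C \<le> card K" if C: "C \<subseteq> rcosets H" "finite C" for C
  proof -
    have "\<forall>c\<in>C. \<exists>x\<in>carrier G. c = H #> x"
      using C(1) by (auto simp: RCOSETS_def)
    then obtain \<rho> where \<rho>: "\<forall>c\<in>C. \<rho> c \<in> carrier G \<and> c = H #> \<rho> c"
      by metis
    have "finite (\<rho> ` C)" "\<rho> ` C \<subseteq> carrier G"
      using C(2) \<rho> by auto
    from separate[OF this] obtain \<kappa> where \<kappa>: "\<kappa> \<in> \<rho> ` C \<rightarrow> K"
      "\<forall>x\<in>\<rho> ` C. \<forall>y\<in>\<rho> ` C. \<kappa> x = \<kappa> y \<longrightarrow> x \<otimes> inv y \<in> H"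
      by (rule bexE)
    have "inj_on (\<kappa> \<circ> \<rho>) C"
    proof (rule inj_onI)
      fix c d assume cd: "c \<in> C" "d \<in> C" "(\<kappa> \<circ> \<rho>) c = (\<kappa> \<circ> \<rho>) d"
      then have "\<rho> c \<in> H #> \<rho> d"
        using subgroup.rcos_module[OF H is_group, of "\<rho> d" "\<rho> c"] \<rho>
          \<kappa>(2)[rule_format, of "\<rho> c" "\<rho> d"] by simp
      then have "H #> \<rho> d = H #> \<rho> c"
        using \<rho> cd(2) H by (intro repr_independence) simp_all
      then show "c = d"
        using \<rho> cd by metis
    qed
    moreover have "(\<kappa> \<circ> \<rho>) ` C \<subseteq> K"
      using \<kappa>(1) by auto
    ultimately show ?thesis
      using K by (rule card_inj_on_le)
  qed
  then show ?thesis
    by (intro finite_if_finite_subsets_card_bdd[THEN conjunct1, of _ "card K"]) blast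
qed

section \<open>The group of extended symmetries, its shifts and its matrices\<close>

lemma ext_symmetriesI:
  assumes "f \<in> Bij X" "invertible A" "intertwines X f A"
    "continuous_map (subtopology full_shift_topology X) (subtopology full_shift_topology X) f"
  shows "f \<in> ext_symmetries X"
  using assms by (auto simp: ext_symmetries_def)

lemma ext_symmetriesD:
  assumes "f \<in> ext_symmetries X"
  shows "f \<in> Bij X" "f \<in> X \<rightarrow> X" "f \<in> extensional X" "bij_betw f X X"
    "continuous_map (subtopology full_shift_topology X) (subtopology full_shift_topology X) f"
    "\<exists>A B. A ** B = mat 1 \<and> B ** A = mat 1 \<and> intertwines X f A"
  using assms by (auto simp: ext_symmetries_def Bij_def bij_betw_imp_funcset invertible_def)

lemma invertible_int_mult:
  fixes A C :: "int ^ 'd ^ 'd"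
  shows "invertible A \<Longrightarrow> invertible C \<Longrightarrow> invertible (A ** C)"
  using monoid.m_closed[OF group.is_monoid[OF group_GL_int], of A C] by simp

context closed_subshift
begin

lemma intertwines_compose:
  assumes g: "g \<in> X \<rightarrow> X" and A: "intertwines X f A" and C: "intertwines X g C"
  shows "intertwines X (compose X f g) (A ** C)"
  unfolding intertwines_def
proof (intro allI ballI)
  fix p x assume x: "x \<in> X"
  have "compose X f g (shift p x) = f (shift (C *v p) (g x))"
    using C x shift_in by (simp add: compose_def intertwines_def)
  also have "\<dots> = shift (A *v (C *v p)) (f (g x))"
    using A x g by (simp add: intertwines_def Pi_iff)
  finally show "compose X f g (shift p x) = shift (A ** C *v p) (compose X f g x)"
    using x by (simp add: compose_def matrix_vector_mul_assoc)
qed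

lemma ext_symmetries_compose:
  assumes f: "f \<in> ext_symmetries X" and g: "g \<in> ext_symmetries X"
  shows "compose X f g \<in> ext_symmetries X"
proof -
  obtain A where A: "invertible A" "intertwines X f A"
    using f by (auto simp: ext_symmetries_def)
  obtain C where C: "invertible C" "intertwines X g C"
    using g by (auto simp: ext_symmetries_def)
  have "continuous_map (subtopology full_shift_topology X) (subtopology full_shift_topology X) (compose X f g)"
    by (rule continuous_map_eq[OF continuous_map_compose[OF ext_symmetriesD(5)[OF g] ext_symmetriesD(5)[OF f]]])
      (simp add: compose_def full_shift_topology_def)
  then show ?thesis
    using A C ext_symmetriesD[OF f] ext_symmetriesD[OF g]
    by (intro ext_symmetriesI[of _ _ "A ** C"] compose_Bij invertible_int_mult intertwines_compose) auto
qed

text \<open>Continuity of the inverse comes from \<open>inverse_local_rule\<close>: moving position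
  \<open>m\<close> of \<open>g y\<close> to 0 moves \<open>y\<close> by \<open>A *v m\<close>, so
  \<open>g y m\<close> is determined by \<open>y\<close> on a cube around
  \<open>A *v m\<close>.\<close>

lemma ext_symmetries_inverse:
  assumes f: "f \<in> ext_symmetries X" and A: "intertwines X f A" and AB: "A ** B = mat 1" "B ** A = mat 1"
  defines "g \<equiv> \<lambda>x\<in>X. inv_into X f x"
  shows "g \<in> ext_symmetries X" "intertwines X g B"
proof -
  note bij = ext_symmetriesD(4)[OF f]
  have gX: "g x \<in> X" and fg: "f (g x) = x" if "x \<in> X" for x
    using that bij by (auto simp: g_def bij_betw_def inv_into_into f_inv_into_f)
  have fX: "f x \<in> X" if "x \<in> X" for x
    using ext_symmetriesD(2)[OF f] that by blast
  have inj: "inj_on f X"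
    using bij by (simp add: bij_betw_def)
  have f_shift: "f (shift p x) = shift (A *v p) (f x)" if "x \<in> X" for p x
    using A that by (simp add: intertwines_def)
  have g_shift: "g (shift p x) = shift (B *v p) (g x)" if x: "x \<in> X" for p x
  proof (rule inj_onD[OF inj])
    show "f (g (shift p x)) = f (shift (B *v p) (g x))"
      using x by (simp add: f_shift gX fg shift_in matrix_vector_mul_assoc AB)
  qed (intro gX shift_in x)+
  then show B: "intertwines X g B"
    by (simp add: intertwines_def)
  obtain r where r: "\<And>x y. x \<in> X \<Longrightarrow> y \<in> X \<Longrightarrow> (\<forall>m\<in>cube r. f x m = f y m) \<Longrightarrow> x 0 = y 0"
    by (rule inverse_local_rule[OF ext_symmetriesD(5)[OF f] inj]) blast
  have "continuous_map (subtopology full_shift_topology X) (subtopology full_shift_topology X) g"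
    unfolding continuous_map_full_shift_iff
  proof (intro conjI ballI allI)
    show "g \<in> X \<rightarrow> X"
      using gX by blast
    fix x m assume x: "x \<in> X"
    have "g y m = g x m" if y: "y \<in> X" "\<forall>k\<in>(\<lambda>c. c + A *v m) ` cube r. y k = x k" for y
    proof -
      have minus: "A *v (- m) = - (A *v m)"
        by (simp add: vec_eq_iff matrix_vector_mult_def sum_negf)
      have f_shift_g: "f (shift (- m) (g z)) = shift (- (A *v m)) z" if "z \<in> X" for z
        using f_shift[OF gX[OF that], of "- m"] unfolding fg[OF that] minus .
      have "shift (- m) (g y) 0 = shift (- m) (g x) 0"
      proof (rule r[of "shift (- m) (g y)" "shift (- m) (g x)"]; (intro shift_in gX y(1) x ballI)?)
        fix c :: "int ^ 'd" assume "c \<in> cube r"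
        then have "y (c + A *v m) = x (c + A *v m)"
          using y(2) by simp
        then show "f (shift (- m) (g y)) c = f (shift (- m) (g x)) c"
          unfolding f_shift_g[OF y(1)] f_shift_g[OF x] by simp
      qed
      then show ?thesis
        by simp
    qed
    moreover have "finite ((\<lambda>c. c + A *v m) ` cube r)"
      by (intro finite_imageI finite_cube)
    ultimately show "\<exists>F. finite F \<and> (\<forall>y\<in>X. (\<forall>k\<in>F. y k = x k) \<longrightarrow> g y m = g x m)"
      by (intro exI[of _ "(\<lambda>c. c + A *v m) ` cube r"]) simp
  qed
  moreover have "g \<in> Bij X"
    unfolding g_def by (rule restrict_inv_into_Bij[OF ext_symmetriesD(1)[OF f]])
  moreover have "invertible B"
    using AB by (auto simp: invertible_def)
  ultimately show "g \<in> ext_symmetries X"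
    using B by (intro ext_symmetriesI)
qed

definition restricted_shift :: "int ^ 'd \<Rightarrow> (int ^ 'd \<Rightarrow> 'a) \<Rightarrow> int ^ 'd \<Rightarrow> 'a" where
  "restricted_shift p = restrict (shift p) X"

lemma restricted_shift:
  "restricted_shift p \<in> ext_symmetries X" "intertwines X (restricted_shift p) (mat 1)"
proof -
  have "bij_betw (shift p) X X"
    by (rule bij_betw_byWitness[where f' = "shift (- p)"]) (auto simp: shift_shift shift_in)
  then have "restricted_shift p \<in> Bij X"
    by (simp add: restricted_shift_def Bij_def)
  moreover show int: "intertwines X (restricted_shift p) (mat 1)"
    by (simp add: intertwines_def restricted_shift_def shift_in shift_shift add.commute)
  moreover have "continuous_map (subtopology full_shift_topology X) (subtopology full_shift_topology X) (restricted_shift p)"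
    unfolding continuous_map_full_shift_iff
  proof (intro conjI ballI allI)
    show "restricted_shift p \<in> X \<rightarrow> X"
      by (simp add: restricted_shift_def shift_in)
    fix x m assume "x \<in> X"
    then show "\<exists>F. finite F \<and> (\<forall>y\<in>X. (\<forall>k\<in>F. y k = x k) \<longrightarrow> restricted_shift p y m = restricted_shift p x m)"
      by (intro exI[of _ "{m - p}"]) (simp add: restricted_shift_def)
  qed
  moreover have "invertible (mat 1 :: int ^ 'd ^ 'd)"
    by (auto simp: invertible_def intro: exI[of _ "mat 1"])
  ultimately show "restricted_shift p \<in> ext_symmetries X"
    by (intro ext_symmetriesI)
qed

lemma subgroup_ext_symmetries: "subgroup (ext_symmetries X) (BijGroup X)"
proof (rule group.subgroupI[OF group_BijGroup])
  show "ext_symmetries X \<subseteq> carrier (BijGroup X)"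
    by (auto simp: BijGroup_def ext_symmetries_def)
  show "ext_symmetries X \<noteq> {}"
    using restricted_shift(1) by blast
  fix f assume f: "f \<in> ext_symmetries X"
  obtain A B where "intertwines X f A" "A ** B = mat 1" "B ** A = mat 1"
    using ext_symmetriesD(6)[OF f] by blast
  then show "inv\<^bsub>BijGroup X\<^esub> f \<in> ext_symmetries X"
    unfolding inv_BijGroup[OF ext_symmetriesD(1)[OF f]] by (rule ext_symmetries_inverse(1)[OF f])
  fix g assume g: "g \<in> ext_symmetries X"
  show "f \<otimes>\<^bsub>BijGroup X\<^esub> g \<in> ext_symmetries X"
    using ext_symmetries_compose[OF f g] ext_symmetriesD(1)[OF f] ext_symmetriesD(1)[OF g]
    by (simp add: BijGroup_def)
qed

lemma group_Sym_group: "group (Sym_group X)"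
  unfolding Sym_group_def by (rule subgroup.subgroup_is_group[OF subgroup_ext_symmetries group_BijGroup])

lemma carrier_Sym_group [simp]: "carrier (Sym_group X) = ext_symmetries X"
  by (simp add: Sym_group_def)

lemma mult_Sym_group:
  "f \<in> ext_symmetries X \<Longrightarrow> g \<in> ext_symmetries X \<Longrightarrow> f \<otimes>\<^bsub>Sym_group X\<^esub> g = compose X f g"
  by (simp add: Sym_group_def BijGroup_def ext_symmetriesD(1))

lemma restricted_shift_hom: "restricted_shift \<in> hom int_lattice (Sym_group X)"
proof (rule homI)
  fix p q :: "int ^ 'd"
  show "restricted_shift (p \<otimes>\<^bsub>int_lattice\<^esub> q) = restricted_shift p \<otimes>\<^bsub>Sym_group X\<^esub> restricted_shift q"
    unfolding mult_Sym_group[OF restricted_shift(1) restricted_shift(1)]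
    by (auto simp: restricted_shift_def compose_def int_lattice_def shift_shift shift_in intro!: restrict_ext)
qed (simp add: restricted_shift(1))

lemma subgroup_restricted_shift: "subgroup (range restricted_shift) (Sym_group X)"
proof -
  interpret group_hom int_lattice "Sym_group X" restricted_shift
    by (intro group_hom.intro group_hom_axioms.intro group_int_lattice group_Sym_group restricted_shift_hom)
  show ?thesis
    using img_is_subgroup by (simp add: int_lattice_def)
qed

lemma restricted_shift_iso:
  assumes "faithful_shift X"
  shows "Sym_group X\<lparr>carrier := range restricted_shift\<rparr> \<cong> (int_lattice :: (int ^ 'd) monoid)"
proof -
  have "inj restricted_shift"
  proof (rule injI)
    fix p q assume eq: "restricted_shift p = restricted_shift q"
    have "shift (p - q) x = x" if "x \<in> X" for x
    proof -
      have "shift p (shift (- q) x) = shift q (shift (- q) x)"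
        using fun_cong[OF eq, of "shift (- q) x"] that by (simp add: restricted_shift_def shift_in)
      then show ?thesis
        by (simp add: shift_shift)
    qed
    then have "p - q = 0"
      using assms unfolding faithful_shift_def by blast
    then show "p = q"
      by simp
  qed
  then have bij: "bij_betw restricted_shift (carrier int_lattice) (carrier (Sym_group X\<lparr>carrier := range restricted_shift\<rparr>))"
    by (simp add: int_lattice_def bij_betw_def)
  have "restricted_shift \<in> hom int_lattice (Sym_group X\<lparr>carrier := range restricted_shift\<rparr>)"
    using restricted_shift_hom by (simp add: hom_def)
  then have "(int_lattice :: (int ^ 'd) monoid) \<cong> Sym_group X\<lparr>carrier := range restricted_shift\<rparr>"
    by (rule is_isoI[OF isoI[OF _ bij]])
  then show ?thesis
    by (rule group.iso_sym[OF group_int_lattice])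
qed

lemma psi_properties:
  assumes "faithful_shift X" "f \<in> ext_symmetries X"
  shows "invertible (psi X f)" "intertwines X f (psi X f)"
proof -
  obtain A where "invertible A" "intertwines X f A"
    using assms(2) by (auto simp: ext_symmetries_def)
  moreover from this have "psi X f = A"
    using assms by (intro psi_eq ext_symmetriesD(1))
  ultimately show "invertible (psi X f)" "intertwines X f (psi X f)"
    by simp_all
qed

text \<open>The product of the two matrices intertwines the composition, and faithfulness makes that
  matrix unique.\<close>

lemma psi_hom:
  assumes faithful: "faithful_shift X"
  shows "psi X \<in> hom (Sym_group X) GL_int"
proof (rule homI)
  fix f g assume "f \<in> carrier (Sym_group X)" "g \<in> carrier (Sym_group X)"
  then have fg: "f \<in> ext_symmetries X" "g \<in> ext_symmetries X"
    by simp_all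
  have "psi X (compose X f g) = psi X f ** psi X g"
    using fg psi_properties[OF faithful]
    by (intro psi_eq faithful ext_symmetriesD(1) ext_symmetries_compose invertible_int_mult
        intertwines_compose ext_symmetriesD(2)) auto
  then show "psi X (f \<otimes>\<^bsub>Sym_group X\<^esub> g) = psi X f \<otimes>\<^bsub>GL_int\<^esub> psi X g"
    by (simp add: mult_Sym_group fg)
qed (simp add: psi_properties[OF faithful])

end

section \<open>Image of psi and index of the shifts\<close>

context rect_subst
begin

text \<open>\<open>inverse_matrix_rows\<close> controls the rows of the inverse of a matrix. It is
  applied to the inverse symmetry, whose inverse matrix is \<open>psi X f\<close> itself.\<close>

lemma psi_hyperoctahedral:
  assumes faithful: "faithful_shift X" and f: "f \<in> ext_symmetries X"
  shows "psi X f \<in> hyperoctahedral"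
proof -
  obtain B where AB: "psi X f ** B = mat 1" "B ** psi X f = mat 1"
    using psi_properties(1)[OF assms] by (auto simp: invertible_def)
  note inverse = ext_symmetries_inverse[OF f psi_properties(2)[OF assms] AB]
  show ?thesis
    by (rule monomial_rows_hyperoctahedral[OF AB(1)])
      (rule inverse_matrix_rows[OF faithful inverse AB(2)])
qed

text \<open>Within a finite set of symmetries, the coset of \<open>f\<close> is determined by
  \<open>psi X f\<close> together with the letter map of \<open>f\<close> divided by a
  representative with the same matrix.\<close>

lemma finite_rcosets_restricted_shift:
  assumes faithful: "faithful_shift X" and x0: "x0 \<in> X"
  shows "finite (rcosets\<^bsub>Sym_group X\<^esub> (range restricted_shift))"
proof -
  interpret psi: group_hom "Sym_group X" GL_int "psi X"
    by (intro group_hom.intro group_hom_axioms.intro group_GL_int group_Sym_group psi_hom[OF faithful])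
  let ?G = "Sym_group X"
  show ?thesis
  proof (rule psi.G.finite_rcosetsI[OF subgroup_restricted_shift])
    show "finite ((hyperoctahedral :: (int ^ 'd ^ 'd) set) \<times> (UNIV :: ('a \<Rightarrow> 'a) set))"
      by (intro finite_cartesian_product finite_hyperoctahedral) simp
    fix S :: "((int ^ 'd \<Rightarrow> 'a) \<Rightarrow> int ^ 'd \<Rightarrow> 'a) set"
    assume S: "finite S" "S \<subseteq> carrier ?G"
    \<comment> \<open>The representative depends on \<open>f\<close> only through
      \<open>psi X f\<close>, so equal matrices have equal representatives.\<close>
    define rep where "rep = (\<lambda>f. SOME f'. f' \<in> S \<and> psi X f' = psi X f)"
    have rep: "rep f \<in> S" "psi X (rep f) = psi X f" if "f \<in> S" for f
      using someI[of "\<lambda>f'. f' \<in> S \<and> psi X f' = psi X f" f] that by (simp_all add: rep_def)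
    define \<eta> where "\<eta> = (\<lambda>f. f \<otimes>\<^bsub>?G\<^esub> inv\<^bsub>?G\<^esub> rep f)"
    have carrier: "f \<in> carrier ?G" "rep f \<in> carrier ?G" if "f \<in> S" for f
      using S(2) rep(1)[OF that] that by blast+
    have \<eta>: "\<eta> f \<in> ext_symmetries X" "intertwines X (\<eta> f) (mat 1)" if "f \<in> S" for f
    proof -
      have "\<eta> f \<in> carrier ?G"
        unfolding \<eta>_def using carrier[OF that] by (intro psi.G.m_closed psi.G.inv_closed)
      then show *: "\<eta> f \<in> ext_symmetries X"
        by simp
      have "psi X (\<eta> f) = psi X f \<otimes>\<^bsub>GL_int\<^esub> inv\<^bsub>GL_int\<^esub> psi X (rep f)"
        unfolding \<eta>_def using carrier[OF that]
        by (simp only: psi.hom_mult psi.hom_inv psi.G.inv_closed)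
      also have "\<dots> = \<one>\<^bsub>GL_int\<^esub>"
        unfolding rep(2)[OF that] by (intro psi.H.r_inv psi.hom_closed carrier that)
      finally show "intertwines X (\<eta> f) (mat 1)"
        using psi_properties(2)[OF faithful *] by simp
    qed
    have "\<forall>\<^sub>F n in sequentially. \<forall>f\<in>S. \<exists>\<tau> g. \<forall>x\<in>X. \<forall>m. \<eta> f (T n x) m = T n (\<tau> \<circ> x) (m + g)"
      using S(1) \<eta> x0 by (intro eventually_ball_finite ballI automorphism_on_inflated)
    \<comment> \<open>Finitely many symmetries admit a common level, at which their letter maps can
      be compared.\<close>
    then obtain n where "\<forall>f\<in>S. \<exists>\<tau> g. \<forall>x\<in>X. \<forall>m. \<eta> f (T n x) m = T n (\<tau> \<circ> x) (m + g)"
      by (auto simp: eventually_sequentially)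
    then obtain \<tau> where "\<forall>f\<in>S. \<exists>g. \<forall>x\<in>X. \<forall>m. \<eta> f (T n x) m = T n (\<tau> f \<circ> x) (m + g)"
      by (rule bchoice[THEN exE])
    then obtain g where g: "\<forall>f\<in>S. \<forall>x\<in>X. \<forall>m. \<eta> f (T n x) m = T n (\<tau> f \<circ> x) (m + g f)"
      by (rule bchoice[THEN exE])
    show "\<exists>\<kappa> \<in> S \<rightarrow> (hyperoctahedral :: (int ^ 'd ^ 'd) set) \<times> (UNIV :: ('a \<Rightarrow> 'a) set). \<forall>f\<in>S. \<forall>f'\<in>S. \<kappa> f = \<kappa> f' \<longrightarrow>
        f \<otimes>\<^bsub>?G\<^esub> inv\<^bsub>?G\<^esub> f' \<in> range restricted_shift"
    proof (rule bexI[of _ "\<lambda>f. (psi X f, \<tau> f)"], intro ballI impI)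
      fix f f' assume f: "f \<in> S" and f': "f' \<in> S" and "(psi X f, \<tau> f) = (psi X f', \<tau> f')"
      then have eq: "rep f = rep f'" "\<tau> f = \<tau> f'"
        by (simp_all add: rep_def)
      obtain p where p: "\<forall>x\<in>X. \<eta> f x = shift p (\<eta> f' x)"
        using automorphisms_equal_mod_shift[OF \<eta>[OF f] \<eta>[OF f'] x0, of n "\<tau> f" "g f" "g f'"] g f f' eq(2)
        by auto
      have "\<eta> f = compose X (restricted_shift p) (\<eta> f')"
      proof (rule extensionalityI)
        show "\<eta> f \<in> extensional X"
          using \<eta>(1)[OF f] by (rule ext_symmetriesD(3))
        fix x assume x: "x \<in> X"
        then have "\<eta> f' x \<in> X"
          using ext_symmetriesD(2)[OF \<eta>(1)[OF f']] by blast
        then show "\<eta> f x = compose X (restricted_shift p) (\<eta> f') x"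
          using x p by (simp add: compose_def restricted_shift_def)
      qed (simp add: compose_def)
      then have "\<eta> f = restricted_shift p \<otimes>\<^bsub>?G\<^esub> \<eta> f'"
        by (simp add: mult_Sym_group restricted_shift(1) \<eta>(1)[OF f'])
      moreover have c: "restricted_shift p \<in> carrier ?G" "f' \<in> carrier ?G"
          "inv\<^bsub>?G\<^esub> rep f' \<in> carrier ?G"
        using restricted_shift(1)[of p] carrier[OF f'] psi.G.inv_closed[of "rep f'"] by simp_all
      \<comment> \<open>Cancelling the common representative on the right leaves \<open>f\<close> as
        a shift times \<open>f'\<close>.\<close>
      ultimately have "f \<otimes>\<^bsub>?G\<^esub> inv\<^bsub>?G\<^esub> rep f' = (restricted_shift p \<otimes>\<^bsub>?G\<^esub> f') \<otimes>\<^bsub>?G\<^esub> inv\<^bsub>?G\<^esub> rep f'"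
        unfolding \<eta>_def eq(1) by (simp only: psi.G.m_assoc[OF c])
      then have "f = restricted_shift p \<otimes>\<^bsub>?G\<^esub> f'"
        by (simp only: psi.G.right_cancel[OF c(3) carrier(1)[OF f] psi.G.m_closed[OF c(1,2)]])
      then have "f \<otimes>\<^bsub>?G\<^esub> inv\<^bsub>?G\<^esub> f' = restricted_shift p"
        by (simp only: psi.G.m_assoc[OF c(1,2) psi.G.inv_closed[OF c(2)]] psi.G.r_inv[OF c(2)] psi.G.r_one[OF c(1)])
      then show "f \<otimes>\<^bsub>?G\<^esub> inv\<^bsub>?G\<^esub> f' \<in> range restricted_shift"
        by blast
    next
      show "(\<lambda>f. (psi X f, \<tau> f)) \<in> S \<rightarrow> hyperoctahedral \<times> UNIV"
        using psi_hyperoctahedral[OF faithful] S(2) by auto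
    qed
  qed
qed

end

theorem theorem24:
  fixes s :: "int ^ 'd" and \<theta> :: "'a::finite \<Rightarrow> int ^ 'd \<Rightarrow> 'a"
  assumes "nontrivial_subst s"
    and "primitive_subst s \<theta>"
    and "bijective_subst s \<theta>"
    and "faithful_shift (minimal_subshift s \<theta>)"
  shows "subgroup (psi (minimal_subshift s \<theta>) ` ext_symmetries (minimal_subshift s \<theta>))
           (GL_int\<lparr>carrier := hyperoctahedral\<rparr>) \<and>
         subgroup (hyperoctahedral :: (int ^ 'd ^ 'd) set) GL_int \<and>
         virtually (Sym_group (minimal_subshift s \<theta>)) (int_lattice :: (int ^ 'd) monoid)"
proof -
  interpret rect_subst s \<theta>
    by unfold_locales (fact assms)+
  note faithful = assms(4)
  \<comment> \<open>Over the empty set every shift acts trivially, so faithfulness and a nonzero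
    vector provide a point of \<open>X\<close>.\<close>
  have "axis undefined 1 \<noteq> (0 :: int ^ 'd)"
    by (simp add: axis_eq_0_iff)
  then obtain x0 where x0: "x0 \<in> X"
    using faithful unfolding faithful_shift_def by blast
  have "psi X \<in> hom (Sym_group X) (GL_int\<lparr>carrier := hyperoctahedral\<rparr>)"
    using psi_hom[OF faithful] psi_hyperoctahedral[OF faithful] by (simp add: hom_def Pi_iff)
  then interpret psi: group_hom "Sym_group X" "GL_int\<lparr>carrier := hyperoctahedral\<rparr>" "psi X"
    by (intro group_hom.intro group_hom_axioms.intro group_Sym_group
        subgroup.subgroup_is_group[OF subgroup_hyperoctahedral group_GL_int])
  have "subgroup (psi X ` ext_symmetries X) (GL_int\<lparr>carrier := hyperoctahedral\<rparr>)"
    using psi.img_is_subgroup by simp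
  moreover have "virtually (Sym_group X) (int_lattice :: (int ^ 'd) monoid)"
    unfolding virtually_def
    using group_Sym_group subgroup_restricted_shift finite_rcosets_restricted_shift[OF faithful x0]
      restricted_shift_iso[OF faithful] by blast
  ultimately show ?thesis
    using subgroup_hyperoctahedral by blast
qed

end
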